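(* Let $\alpha\in(0,1)$ and let $t_0<t_1$ be real numbers. Let $f\in C^0([t_0,t_1];\mathbb{R})$ satisfy $g_{1-\alpha}*f\in W^{1,1}(t_0,t_1;\mathbb{R})$ and $g_{1-\alpha}*f^2\in W^{1,1}(t_0,t_1;\mathbb{R})$. Then $$cD_{t_0,t}^\alpha\big[f(t)\big]^2\leq 2\Big[cD_{t_0,t}^\alpha f(t)\Big]f(t),\quad\text{for almost every }t\in[t_0,t_1].$$
   Context: For $\beta>0$, $g_\beta:\mathbb{R}\to\mathbb{R}$ is $g_\beta(t)=t^{\beta-1}/\Gamma(\beta)$ for $t>0$ and $g_\beta(t)=0$ for $t\le 0$. A function $f$ on $[t_0,t_1]$ is extended by zero outside $[t_0,t_1]$, so that $(g_{1-\alpha}*f)(t)=\frac{1}{\Gamma(1-\alpha)}\int_{t_0}^t(t-s)^{-\alpha}f(s)\,ds$ for $t\in[t_0,t_1]$. If $f\in L^1(t_0,t_1)$ and $g_{1-\alpha}*f\in W^{1,1}(t_0,t_1)$, the Riemann-Liouville fractional derivative of order $\alpha\in(0,1)$ at $t_0$ is $D_{t_0,t}^\alpha f(t)=\frac{d}{dt}(g_{1-\alpha}*f)(t)$ (weak derivative), for a.e. $t\in[t_0,t_1]$. If moreover $f\in C^0([t_0,t_1])$, the Caputo fractional derivative of order $\alpha$ at $t_0$ is $cD_{t_0,t}^\alpha f(t)=D_{t_0,t}^\alpha[f(t)-f(t_0)]$, for a.e. $t\in[t_0,t_1]$. $cD_{t_0,t}^\alpha[f(t)]^2$ denotes the derivative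 of the function $t\mapsto f(t)^2$. *)

theory Defs
  imports "HOL-Analysis.Analysis"
begin

section \<open>Sobolev space \<open>W\<^sup>1\<^sup>,\<^sup>1\<close> on a bounded interval\<close>

definition test_function :: "real \<Rightarrow> real \<Rightarrow> (real \<Rightarrow> real) \<Rightarrow> bool" where
  "test_function a b \<phi> \<longleftrightarrow>
     (\<forall>n. ((deriv ^^ n) \<phi>) differentiable_on UNIV) \<and>
     compact (closure {x. \<phi> x \<noteq> 0}) \<and> closure {x. \<phi> x \<noteq> 0} \<subseteq> {a<..<b}"

definition has_weak_derivative :: "(real \<Rightarrow> real) \<Rightarrow> (real \<Rightarrow> real) \<Rightarrow> real \<Rightarrow> real \<Rightarrow> bool" where
  "has_weak_derivative u v a b \<longleftrightarrow>
     u absolutely_integrable_on {a<..<b} \<and> v absolutely_integrable_on {a<..<b} \<and>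
     (\<forall>\<phi>. test_function a b \<phi> \<longrightarrow>
        (LINT x:{a<..<b}|lebesgue. u x * deriv \<phi> x) = - (LINT x:{a<..<b}|lebesgue. v x * \<phi> x))"

definition W11 :: "real \<Rightarrow> real \<Rightarrow> (real \<Rightarrow> real) set" where
  "W11 a b = {u. \<exists>v. has_weak_derivative u v a b}"

text \<open>The weak derivative is only determined up to null sets; this picks a representative.
  It is meaningful only for members of \<^const>\<open>W11\<close>, and only for statements
  that hold almost everywhere.\<close>

definition weak_deriv :: "real \<Rightarrow> real \<Rightarrow> (real \<Rightarrow> real) \<Rightarrow> real \<Rightarrow> real" where
  "weak_deriv a b u = (SOME v. has_weak_derivative u v a b)"


section \<open>Fractional derivatives\<close>

definition frac_kernel :: "real \<Rightarrow> real \<Rightarrow> real" where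
  "frac_kernel \<beta> t = (if t > 0 then t powr (\<beta> - 1) / Gamma \<beta> else 0)"

definition zero_extension :: "real \<Rightarrow> real \<Rightarrow> (real \<Rightarrow> real) \<Rightarrow> real \<Rightarrow> real" where
  "zero_extension a b f t = (if t \<in> {a..b} then f t else 0)"

definition convolve :: "(real \<Rightarrow> real) \<Rightarrow> (real \<Rightarrow> real) \<Rightarrow> real \<Rightarrow> real" where
  "convolve g f t = (LINT s|lebesgue. g (t - s) * f s)"

definition frac_conv :: "real \<Rightarrow> real \<Rightarrow> real \<Rightarrow> (real \<Rightarrow> real) \<Rightarrow> real \<Rightarrow> real" where
  "frac_conv \<beta> a b f = convolve (frac_kernel \<beta>) (zero_extension a b f)"

lemma frac_conv_eq:
  assumes "t \<in> {a..b}"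
  shows "frac_conv (1 - \<alpha>) a b f t =
           1 / Gamma (1 - \<alpha>) * (LINT s:{a..t}|lebesgue. (t - s) powr (- \<alpha>) * f s)"
proof -
  have "frac_conv (1 - \<alpha>) a b f t =
      (LINT s|lebesgue. 1 / Gamma (1 - \<alpha>) * (indicator {a..t} s *\<^sub>R ((t - s) powr (- \<alpha>) * f s)))"
    unfolding frac_conv_def convolve_def
    using assms
    by (intro Bochner_Integration.integral_cong)
       (auto simp: frac_kernel_def zero_extension_def indicator_def)
  then show ?thesis
    by (simp add: set_lebesgue_integral_def)
qed

definition riemann_liouville_deriv ::
    "real \<Rightarrow> real \<Rightarrow> real \<Rightarrow> (real \<Rightarrow> real) \<Rightarrow> real \<Rightarrow> real" where
  "riemann_liouville_deriv \<alpha> a b f = weak_deriv a b (frac_conv (1 - \<alpha>) a b f)"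

definition caputo_deriv ::
    "real \<Rightarrow> real \<Rightarrow> real \<Rightarrow> (real \<Rightarrow> real) \<Rightarrow> real \<Rightarrow> real" where
  "caputo_deriv \<alpha> a b f = riemann_liouville_deriv \<alpha> a b (\<lambda>t. f t - f a)"

end

theory Submission imports Defs begin

text \<open>
  Write \<open>I\<^sup>\<beta>\<close> for convolution with \<^const>\<open>frac_kernel\<close> of order \<open>\<beta>\<close>, and let \<open>V1\<close>, \<open>V2\<close> be the
  Caputo derivatives of \<open>f\<close> and \<open>f\<^sup>2\<close>.  By Abel inversion \<open>f - f t0 = I\<^sup>\<alpha> V1\<close> and
  \<open>f\<^sup>2 - (f t0)\<^sup>2 = I\<^sup>\<alpha> V2\<close> almost everywhere.  Fix a generic time \<open>\<tau>\<close> and put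
  \<open>\<psi> = V2 - 2 f(\<tau>) V1\<close>.  Then \<open>I\<^sup>\<alpha> \<psi>\<close> equals \<open>(f - f \<tau>)\<^sup>2\<close> up to a constant, so it has a minimum
  at \<open>\<tau>\<close>.  For \<open>0 < \<epsilon> < \<alpha>\<close> the Marchaud formula for the derivative of order \<open>\<alpha> - \<epsilon>\<close> of
  \<open>I\<^sup>\<alpha> \<psi>\<close> converges absolutely and shows \<open>I\<^sup>\<epsilon> \<psi> (\<tau>) \<le> 0\<close>; as \<open>\<epsilon> \<rightarrow> 0\<close> the kernels concentrate at
  the origin, so \<open>\<psi> \<tau> \<le> 0\<close> at left density points.  Passing through \<open>\<epsilon> > 0\<close> is what allows
  \<open>f\<close> to be merely continuous: for order \<open>\<alpha>\<close> itself absolute convergence is not available.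
\<close>

section \<open>The semigroup of fractional kernels\<close>

text \<open>For continuously differentiable \<open>f\<close>, integrating by parts in the Caputo
  integrals writes the difference of the two sides as minus a boundary square and minus an integral
  of (f(s) - f(t))^2 against (t - s)^(-\<alpha>-1). For merely continuous \<open>f\<close> there is
  no derivative to start from, and \<open>V1\<close>, \<open>V2\<close> are only integrable, so the
  sign has to be extracted from the two integral equations. The function \<open>\<psi>\<close>
  changes with \<open>\<tau>\<close>. A null set produced by an almost-everywhere theorem applied to
  \<open>\<psi>\<close> would therefore depend on \<open>\<tau>\<close> and could not be discarded.
  All such theorems are applied to \<open>V1\<close> and \<open>V2\<close>, and properties of
  \<open>\<psi>\<close> follow by linearity. For the same reason \<open>\<epsilon>\<close> runs
  through a sequence: countably many null sets are harmless. The limit in \<open>\<epsilon>\<close>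
  is one-sided. Convergence of the singular integrals is never claimed; a positive left density is
  contradicted because the mass of u^(\<epsilon>-1) near 0 grows like 1/\<epsilon>.\<close>

lemma Fubini_swap:
  fixes F :: "real \<Rightarrow> real \<Rightarrow> real"
  assumes [measurable]: "case_prod F \<in> borel_measurable (borel \<Otimes>\<^sub>M borel)"
    and inner: "AE y in lborel. integrable lborel (\<lambda>x. F x y)"
    and outer: "integrable lborel (\<lambda>y. \<integral>x. \<bar>F x y\<bar> \<partial>lborel)"
  shows "AE x in lborel. integrable lborel (F x)"
    and "integrable lborel (\<lambda>x. \<integral>y. F x y \<partial>lborel)"
    and "(\<integral>x. \<integral>y. F x y \<partial>lborel \<partial>lborel) = (\<integral>y. \<integral>x. F x y \<partial>lborel \<partial>lborel)"
proof -
  have "integrable (lborel \<Otimes>\<^sub>M lborel) (\<lambda>(y, x). F x y)"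
    using inner outer by (intro lborel_pair.Fubini_integrable) auto
  then have int: "integrable (lborel \<Otimes>\<^sub>M lborel) (case_prod F)"
    using lborel_pair.integrable_product_swap[of "\<lambda>(y, x). F x y"] by (simp add: case_prod_unfold)
  from lborel_pair.AE_integrable_fst[OF int] show "AE x in lborel. integrable lborel (F x)" .
  from lborel_pair.integrable_fst[OF int] show "integrable lborel (\<lambda>x. \<integral>y. F x y \<partial>lborel)" .
  from lborel_pair.Fubini_integral[OF int]
  show "(\<integral>x. \<integral>y. F x y \<partial>lborel \<partial>lborel) = (\<integral>y. \<integral>x. F x y \<partial>lborel \<partial>lborel)" by simp
qed

lemma frac_kernel_nonneg: "0 < \<beta> \<Longrightarrow> 0 \<le> frac_kernel \<beta> t"
  unfolding frac_kernel_def by (simp add: Gamma_real_pos less_imp_le)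

lemma frac_kernel_measurable [measurable]: "frac_kernel \<beta> \<in> borel_measurable borel"
  unfolding frac_kernel_def by measurable

lemma frac_kernel_1: "frac_kernel 1 t = indicator {0<..} t"
  unfolding frac_kernel_def by (simp add: Gamma_1 indicator_def)

text \<open>The substitution s = x * u reduces the convolution to Euler's Beta integral, whose Gamma
  quotient cancels the normalisations of the kernels. The nonnegative integral is used so that
  integrability and value come out together.\<close>

lemma frac_kernel_semigroup_nn:
  assumes "0 < \<beta>" "0 < \<gamma>"
  shows "(\<integral>\<^sup>+s. ennreal (frac_kernel \<beta> (x - s) * frac_kernel \<gamma> s) \<partial>lborel)
    = ennreal (frac_kernel (\<beta> + \<gamma>) x)"
proof (cases "x > 0")
  case False
  then have zero: "frac_kernel \<beta> (x - s) * frac_kernel \<gamma> s = 0" for s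
    by (auto simp: frac_kernel_def)
  from False show ?thesis
    unfolding zero by (simp add: frac_kernel_def)
next
  case True
  define c where "c = x powr (\<beta> + \<gamma> - 2) / (Gamma \<beta> * Gamma \<gamma>)"
  have c: "0 \<le> c"
    unfolding c_def using assms by (simp add: Gamma_real_pos less_imp_le)
  have "(\<integral>\<^sup>+s. ennreal (frac_kernel \<beta> (x - s) * frac_kernel \<gamma> s) \<partial>lborel)
    = x * (\<integral>\<^sup>+u. ennreal (frac_kernel \<beta> (x - x * u) * frac_kernel \<gamma> (x * u)) \<partial>lborel)"
    using True by (subst nn_integral_real_affine[where c=x and t=0]) auto
  also have "(\<integral>\<^sup>+u. ennreal (frac_kernel \<beta> (x - x * u) * frac_kernel \<gamma> (x * u)) \<partial>lborel)
     = (\<integral>\<^sup>+u. c * ennreal (indicator {0..1} u * (u powr (\<gamma> - 1) * (1 - u) powr (\<beta> - 1))) \<partial>lborel)"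
  proof (rule nn_integral_cong)
    fix u :: real
    have "frac_kernel \<beta> (x - x * u) * frac_kernel \<gamma> (x * u)
      = c * (indicator {0..1} u * (u powr (\<gamma> - 1) * (1 - u) powr (\<beta> - 1)))"
    proof (cases "0 < u \<and> u < 1")
      case in01: True
      have eq: "x - x * u = x * (1 - u)" by (simp add: algebra_simps)
      have p: "x powr (\<beta> - 1) * x powr (\<gamma> - 1) = x powr (\<beta> + \<gamma> - 2)"
        by (simp flip: powr_add)
      have "frac_kernel \<beta> (x * (1 - u)) * frac_kernel \<gamma> (x * u)
        = x powr (\<beta> - 1) * x powr (\<gamma> - 1) * (u powr (\<gamma> - 1) * (1 - u) powr (\<beta> - 1))
            / (Gamma \<beta> * Gamma \<gamma>)"
        using True in01 by (simp add: frac_kernel_def powr_mult zero_less_mult_iff mult_ac)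
      then show ?thesis
        unfolding p eq c_def using in01 by (simp add: indicator_def)
    next
      case out01: False
      then have "u \<le> 0 \<or> u \<ge> 1" by auto
      moreover have "x * u \<le> 0" if "u \<le> 0"
        using that True by (simp add: mult_nonneg_nonpos)
      moreover have "x - x * u \<le> 0" if "u \<ge> 1"
        using that True by simp
      ultimately have "x - x * u \<le> 0 \<or> x * u \<le> 0" by blast
      then have "frac_kernel \<beta> (x - x * u) * frac_kernel \<gamma> (x * u) = 0"
        by (metis frac_kernel_def mult_eq_0_iff not_less)
      moreover have "indicator {0..1} u * (u powr (\<gamma> - 1) * (1 - u) powr (\<beta> - 1)) = 0"
        using \<open>u \<le> 0 \<or> u \<ge> 1\<close> by (auto simp: indicator_def)
      ultimately show ?thesis by (simp only: mult_zero_right)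
    qed
    then show "ennreal (frac_kernel \<beta> (x - x * u) * frac_kernel \<gamma> (x * u))
      = c * ennreal (indicator {0..1} u * (u powr (\<gamma> - 1) * (1 - u) powr (\<beta> - 1)))"
      using c by (simp add: ennreal_mult')
  qed
  also have "\<dots> = c * ennreal (Beta \<gamma> \<beta>)"
    by (subst nn_integral_cmult, measurable)
      (subst nn_integral_has_integral_lebesgue[OF _ has_integral_Beta_real], use assms in auto)
  also have "ennreal x * (c * ennreal (Beta \<gamma> \<beta>)) = ennreal (x * (c * Beta \<gamma> \<beta>))"
    using True c by (simp add: ennreal_mult')
  also have "x * (c * Beta \<gamma> \<beta>) = frac_kernel (\<beta> + \<gamma>) x"
  proof -
    have nz: "Gamma \<beta> \<noteq> 0" "Gamma \<gamma> \<noteq> 0"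
      using Gamma_real_pos[OF assms(1)] Gamma_real_pos[OF assms(2)] by auto
    have "x * x powr (\<beta> + \<gamma> - 2) = x powr 1 * x powr (\<beta> + \<gamma> - 2)"
      using True by simp
    also have "\<dots> = x powr (\<beta> + \<gamma> - 1)"
      unfolding powr_add[symmetric] by (simp add: algebra_simps)
    finally have "x * x powr (\<beta> + \<gamma> - 2) = x powr (\<beta> + \<gamma> - 1)" .
    with True nz show ?thesis
      unfolding c_def frac_kernel_def Beta_def by (simp add: add.commute field_simps)
  qed
  finally show ?thesis .
qed

lemma frac_kernel_semigroup:
  assumes "0 < \<beta>" "0 < \<gamma>"
  shows "integrable lborel (\<lambda>s. frac_kernel \<beta> (t - s) * frac_kernel \<gamma> (s - r))" (is ?I)
    and "(\<integral>s. frac_kernel \<beta> (t - s) * frac_kernel \<gamma> (s - r) \<partial>lborel) = frac_kernel (\<beta> + \<gamma>) (t - r)" (is ?E)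
proof -
  have "(\<integral>\<^sup>+s. ennreal (frac_kernel \<beta> (t - s) * frac_kernel \<gamma> (s - r)) \<partial>lborel)
     = (\<integral>\<^sup>+s. ennreal (frac_kernel \<beta> ((t - r) - s) * frac_kernel \<gamma> s) \<partial>lborel)"
    by (subst nn_integral_real_affine[where c=1 and t=r]) (auto simp: algebra_simps)
  also have "\<dots> = ennreal (frac_kernel (\<beta> + \<gamma>) (t - r))"
    by (rule frac_kernel_semigroup_nn[OF assms])
  finally have "has_bochner_integral lborel (\<lambda>s. frac_kernel \<beta> (t - s) * frac_kernel \<gamma> (s - r)) (frac_kernel (\<beta> + \<gamma>) (t - r))"
    using assms by (intro has_bochner_integral_nn_integral) (auto simp: frac_kernel_nonneg)
  then show ?I ?E by (auto simp: has_bochner_integral_iff)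
qed

text \<open>From order 1 on, the kernel is nondecreasing, so on the support of \<open>f\<close> it
  stays below its value at t - a. The \<open>max 0\<close> covers t < a.\<close>

lemma frac_kernel_mult_integrable:
  assumes "1 \<le> \<beta>" and f: "integrable lborel f" and supp: "\<And>r. r < a \<Longrightarrow> f r = 0"
  shows "integrable lborel (\<lambda>r. frac_kernel \<beta> (t - r) * f r)"
proof (rule Bochner_Integration.integrable_bound[OF integrable_mult_right[OF f, of "frac_kernel \<beta> (max 0 (t - a))"] _ AE_I2])
  show "(\<lambda>r. frac_kernel \<beta> (t - r) * f r) \<in> borel_measurable lborel"
    using f by measurable
next
  fix r
  have mono: "frac_kernel \<beta> (t - r) \<le> frac_kernel \<beta> (max 0 (t - a))" if "a \<le> r"
    using that assms(1)
    by (auto simp: frac_kernel_def Gamma_real_pos less_imp_le intro!: divide_right_mono powr_mono2)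
  show "norm (frac_kernel \<beta> (t - r) * f r) \<le> norm (frac_kernel \<beta> (max 0 (t - a)) * f r)"
    using assms(1) mono supp[of r]
    by (cases "a \<le> r") (auto simp: abs_mult frac_kernel_nonneg intro!: mult_right_mono)
qed

text \<open>Fubini plus the semigroup law. Total order at least 1 makes the combined kernel bounded
  on the support of \<open>f\<close>, so the identity holds at every \<open>t\<close> and not just
  almost every one. The first claim is a by-product: the outer factor is positive for s < t, so it
  can be cancelled from the integrable slices. With \<beta> = 1 it yields almost-everywhere
  convergence of any fractional integral of \<open>f\<close>.\<close>

lemma frac_kernel_conv_assoc:
  assumes "0 < \<beta>" "0 < \<gamma>" "1 \<le> \<beta> + \<gamma>" and f: "integrable lborel f" and supp: "\<And>r. r < a \<Longrightarrow> f r = 0"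
  shows "AE s in lborel. s < t \<longrightarrow> integrable lborel (\<lambda>r. frac_kernel \<gamma> (s - r) * f r)"
    and "integrable lborel (\<lambda>s. frac_kernel \<beta> (t - s) * (\<integral>r. frac_kernel \<gamma> (s - r) * f r \<partial>lborel))"
    and "(\<integral>s. frac_kernel \<beta> (t - s) * (\<integral>r. frac_kernel \<gamma> (s - r) * f r \<partial>lborel) \<partial>lborel)
       = (\<integral>r. frac_kernel (\<beta> + \<gamma>) (t - r) * f r \<partial>lborel)"
proof -
  have [measurable]: "f \<in> borel_measurable borel" using f by auto
  define F where "F = (\<lambda>s r. frac_kernel \<beta> (t - s) * frac_kernel \<gamma> (s - r) * f r)"
  have F_meas: "case_prod F \<in> borel_measurable (borel \<Otimes>\<^sub>M borel)"
    unfolding F_def by measurable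
  have inner: "integrable lborel (\<lambda>s. F s r)" for r
    unfolding F_def using frac_kernel_semigroup(1)[OF assms(1,2)] by simp
  have "\<bar>F s r\<bar> = frac_kernel \<beta> (t - s) * frac_kernel \<gamma> (s - r) * \<bar>f r\<bar>" for s r
    unfolding F_def using assms by (simp add: abs_mult frac_kernel_nonneg)
  then have abs: "(\<integral>s. \<bar>F s r\<bar> \<partial>lborel) = frac_kernel (\<beta> + \<gamma>) (t - r) * \<bar>f r\<bar>" for r
    using frac_kernel_semigroup[OF assms(1,2), of t r] by simp
  have "integrable lborel (\<lambda>r. frac_kernel (\<beta> + \<gamma>) (t - r) * \<bar>f r\<bar>)"
    using f supp by (intro frac_kernel_mult_integrable[where a=a] assms) auto
  then have outer: "integrable lborel (\<lambda>r. \<integral>s. \<bar>F s r\<bar> \<partial>lborel)"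
    by (simp add: abs)
  note swap = Fubini_swap[OF F_meas AE_I2[OF inner] outer]
  have F_inner: "(\<integral>r. F s r \<partial>lborel) = frac_kernel \<beta> (t - s) * (\<integral>r. frac_kernel \<gamma> (s - r) * f r \<partial>lborel)" for s
    unfolding F_def by (simp add: mult.assoc)
  show "AE s in lborel. s < t \<longrightarrow> integrable lborel (\<lambda>r. frac_kernel \<gamma> (s - r) * f r)"
    using swap(1)
  proof eventually_elim
    case (elim s)
    have "frac_kernel \<beta> (t - s) \<noteq> 0" if "s < t"
      using that Gamma_real_pos[OF assms(1)] by (simp add: frac_kernel_def)
    with elim show ?case unfolding F_def by (auto simp: mult.assoc)
  qed
  show "integrable lborel (\<lambda>s. frac_kernel \<beta> (t - s) * (\<integral>r. frac_kernel \<gamma> (s - r) * f r \<partial>lborel))"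
    using swap(2) by (simp add: F_inner)
  have "(\<integral>s. F s r \<partial>lborel) = frac_kernel (\<beta> + \<gamma>) (t - r) * f r" for r
    unfolding F_def using frac_kernel_semigroup(2)[OF assms(1,2), of t r] by simp
  then show "(\<integral>s. frac_kernel \<beta> (t - s) * (\<integral>r. frac_kernel \<gamma> (s - r) * f r \<partial>lborel) \<partial>lborel)
       = (\<integral>r. frac_kernel (\<beta> + \<gamma>) (t - r) * f r \<partial>lborel)"
    using swap(3) by (simp add: F_inner)
qed

section \<open>A fractional maximum principle\<close>

text \<open>An explicit antiderivative exists because the exponents match. The value 1/\<alpha> is
  also the integral of v^(-1-\<alpha>) over [1, \<infinity>), so the two pieces of the Marchaud
  integral of order \<alpha> cancel exactly.\<close>

lemma marchaud_antiderivative_integral: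
  fixes \<alpha> :: real
  assumes "0 < \<alpha>" "\<alpha> < 1"
  shows "((\<lambda>v. v powr (-1-\<alpha>) * ((1 - v) powr (\<alpha> - 1) - 1)) has_integral 1 / \<alpha>) {0..1}"
proof -
  define F where "F v = v powr (-\<alpha>) * (1 - (1 - v) powr \<alpha>) / \<alpha>" for v :: real
  \<comment> \<open>Needed at the left endpoint: \<open>0 powr _ = 0\<close> sets F 0 = 0 by
    convention, and the bound by a positive power of \<open>v\<close> shows that this is the true
    limit.\<close>
  have bound: "0 \<le> F v \<and> F v \<le> v powr (1 - \<alpha>) / \<alpha>" if "0 < v" "v < 1" for v
  proof -
    have "(1 - v) powr 1 \<le> (1 - v) powr \<alpha>" using that assms by (intro powr_mono') auto
    then have le: "1 - (1 - v) powr \<alpha> \<le> v" using that by simp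
    have "(1 - v) powr \<alpha> \<le> 1 powr \<alpha>" using that assms by (intro powr_mono2) auto
    then have ge: "0 \<le> 1 - (1 - v) powr \<alpha>" by simp
    have "v powr (-\<alpha>) * (1 - (1 - v) powr \<alpha>) \<le> v powr (-\<alpha>) * v"
      using le by (intro mult_left_mono) auto
    also have "v powr (-\<alpha>) * v = v powr (1 - \<alpha>)"
      using that powr_add[of v "-\<alpha>" 1] by simp
    finally show ?thesis unfolding F_def using ge assms by (auto intro!: divide_right_mono)
  qed
  have cont0: "(F \<longlongrightarrow> 0) (at_right 0)"
  proof (rule tendsto_sandwich)
    show "eventually (\<lambda>v. 0 \<le> F v) (at_right 0)"
      using bound by (auto simp: eventually_at_right_field intro!: exI[of _ 1])
    show "eventually (\<lambda>v. F v \<le> v powr (1 - \<alpha>) / \<alpha>) (at_right 0)"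
      using bound by (auto simp: eventually_at_right_field intro!: exI[of _ 1])
    have "((\<lambda>v. v powr (1 - \<alpha>) / \<alpha>) \<longlongrightarrow> 0 powr (1 - \<alpha>) / \<alpha>) (at_right 0)"
      using assms by (intro tendsto_intros) (auto simp: eventually_at_right_field intro!: exI[of _ 1])
    then show "((\<lambda>v. v powr (1 - \<alpha>) / \<alpha>) \<longlongrightarrow> 0) (at_right 0)" by simp
  qed simp
  have cont: "continuous_on {0..1} F"
  proof (rule continuous_on_IccI)
    show "(F \<longlongrightarrow> F 0) (at_right 0)" using cont0 by (simp add: F_def)
    show "(F \<longlongrightarrow> F 1) (at_left 1)"
      unfolding F_def using assms
      by (intro tendsto_intros) (auto simp: eventually_at_left_field intro!: exI[of _ 0])
    show "(F \<longlongrightarrow> F x) (at x)" if "0 < x" "x < 1" for x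
      unfolding F_def using assms that by (intro tendsto_intros) auto
  qed simp
  have der: "(F has_vector_derivative v powr (-1-\<alpha>) * ((1 - v) powr (\<alpha> - 1) - 1)) (at v)"
    if "v \<in> {0<..<1}" for v
  proof -
    have v: "0 < v" "v < 1" using that by auto
    have "(F has_real_derivative
        (-\<alpha> * v powr (-\<alpha> - 1) * (1 - (1 - v) powr \<alpha>) + v powr (-\<alpha>) * (\<alpha> * (1 - v) powr (\<alpha> - 1))) / \<alpha>) (at v)"
      unfolding F_def using v assms
      by (auto intro!: derivative_eq_intros simp: powr_diff divide_simps)
    moreover have "(-\<alpha> * v powr (-\<alpha> - 1) * (1 - (1 - v) powr \<alpha>) + v powr (-\<alpha>) * (\<alpha> * (1 - v) powr (\<alpha> - 1))) / \<alpha>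
       = v powr (-1-\<alpha>) * ((1 - v) powr (\<alpha> - 1) - 1)"
    proof -
      have 1: "v powr (-\<alpha>) = v * v powr (-1-\<alpha>)"
        using v powr_add[of v 1 "-1-\<alpha>"] by simp
      have 2: "(1 - v) powr \<alpha> = (1 - v) * (1 - v) powr (\<alpha> - 1)"
        using v powr_add[of "1-v" 1 "\<alpha>-1"] by simp
      have 3: "-\<alpha> - 1 = -1 - \<alpha>" by simp
      show ?thesis unfolding 1 2 3 using assms by (simp add: field_simps)
    qed
    ultimately show ?thesis
      by (simp add: has_real_derivative_iff_has_vector_derivative)
  qed
  have "((\<lambda>v. v powr (-1-\<alpha>) * ((1 - v) powr (\<alpha> - 1) - 1)) has_integral F 1 - F 0) {0..1}"
    by (rule fundamental_theorem_of_calculus_interior[OF _ cont der]) auto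
  then show ?thesis by (simp add: F_def)
qed

text \<open>Positivity comes from comparison with \<open>\<theta> = \<alpha>\<close>, where the integral vanishes.\<close>

lemma marchaud_constant_pos:
  fixes \<alpha> \<theta> :: real
  assumes "0 < \<theta>" "\<theta> < \<alpha>" "\<alpha> < 1"
  defines "q \<equiv> \<lambda>v. indicator {0<..} v * (v powr (-1-\<theta>) * (1 - (if v < 1 then (1 - v) powr (\<alpha> - 1) else 0)))"
  shows "integrable lborel q" and "0 < (\<integral>v. q v \<partial>lborel)"
proof -
  have [measurable]: "q \<in> borel_measurable borel" unfolding q_def by measurable
  \<comment> \<open>\<open>q1\<close> is the part of \<open>q\<close> on [1, \<infinity>), where the
    translated kernel is absent. On (0,1) the integrand \<open>q\<close> is nonpositive, so q1 - q
    is nonnegative and measures the loss.\<close>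
  define q1 where "q1 v = indicator {1..} v * v powr (-1-\<theta>)" for v :: real
  have [measurable]: "q1 \<in> borel_measurable borel" unfolding q1_def by measurable
  have ge: "0 \<le> (1 - v) powr (\<alpha> - 1) - 1" if "0 \<le> v" "v < 1" for v :: real
    using powr_mono'[of "\<alpha> - 1" 0 "1 - v"] that assms by simp
  have "((\<lambda>v. v powr (-1-\<theta>)) has_integral 1 / \<theta>) {1::real..}"
    using has_integral_powr_to_inf[of "-1-\<theta>" 1] assms by simp
  then have "(\<integral>\<^sup>+v. ennreal (q1 v) \<partial>lborel) = ennreal (1 / \<theta>)"
    unfolding q1_def by (intro nn_integral_has_integral_lebesgue) auto
  then have q1: "has_bochner_integral lborel q1 (1 / \<theta>)"
    using assms by (intro has_bochner_integral_nn_integral) (auto simp: q1_def)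
  define r' where "r' v = indicator {0<..<1} v * (v powr (-1-\<alpha>) * ((1 - v) powr (\<alpha> - 1) - 1))" for v :: real
  have [measurable]: "r' \<in> borel_measurable borel" unfolding r'_def by measurable
  have "((\<lambda>v. v powr (-1-\<alpha>) * ((1 - v) powr (\<alpha> - 1) - 1)) has_integral 1 / \<alpha>) {0<..<1}"
    using marchaud_antiderivative_integral[of \<alpha>] assms
    by (simp add: has_integral_Icc_iff_Ioo)
  then have "(\<integral>\<^sup>+v. ennreal (r' v) \<partial>lborel) = ennreal (1 / \<alpha>)"
    unfolding r'_def using ge by (intro nn_integral_has_integral_lebesgue) auto
  then have r': "has_bochner_integral lborel r' (1 / \<alpha>)"
    using assms ge by (intro has_bochner_integral_nn_integral) (auto simp: r'_def indicator_def)
  \<comment> \<open>For v < 1 the weight of order \<theta> is below that of order \<alpha>. The loss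
    on (0,1) is thus at most 1/\<alpha>, while the tail contributes 1/\<theta>, which is
    larger.\<close>
  have bound: "0 \<le> q1 v - q v \<and> q1 v - q v \<le> r' v" for v
  proof (cases "0 < v \<and> v < 1")
    case True
    have le: "v powr (-1-\<theta>) \<le> v powr (-1-\<alpha>)" using True assms by (intro powr_mono') auto
    have ge': "0 \<le> (1 - v) powr (\<alpha> - 1) - 1" using True by (intro ge) auto
    have "q1 v - q v = v powr (-1-\<theta>) * ((1 - v) powr (\<alpha> - 1) - 1)"
      using True by (simp add: q1_def q_def right_diff_distrib)
    moreover have "r' v = v powr (-1-\<alpha>) * ((1 - v) powr (\<alpha> - 1) - 1)"
      using True by (simp add: r'_def)
    ultimately show ?thesis
      using mult_right_mono[OF le ge'] mult_nonneg_nonneg[OF _ ge', of "v powr (-1-\<theta>)"] by simp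
  next
    case False
    then show ?thesis by (auto simp: q1_def q_def r'_def indicator_def)
  qed
  have int_diff: "integrable lborel (\<lambda>v. q1 v - q v)"
  proof (rule Bochner_Integration.integrable_bound[of _ r'])
    show "integrable lborel r'" using r' by (simp add: has_bochner_integral_iff)
    show "(\<lambda>v. q1 v - q v) \<in> borel_measurable lborel" unfolding q1_def by measurable
    show "AE v in lborel. norm (q1 v - q v) \<le> norm (r' v)"
      using bound by (intro AE_I2) (smt (verit) real_norm_def)
  qed
  have q_eq: "q = (\<lambda>v. q1 v - (q1 v - q v))" by auto
  have i1: "integrable lborel q1" using q1 by (simp add: has_bochner_integral_iff)
  show int: "integrable lborel q"
    by (subst q_eq) (intro Bochner_Integration.integrable_diff i1 int_diff)
  have "(\<integral>v. q1 v - q v \<partial>lborel) \<le> (\<integral>v. r' v \<partial>lborel)"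
    using bound r' by (intro integral_mono int_diff) (auto simp: has_bochner_integral_iff)
  then have "1 / \<theta> - (\<integral>v. q v \<partial>lborel) \<le> 1 / \<alpha>"
    using q1 r' i1 int by (simp add: has_bochner_integral_iff)
  moreover have "1 / \<alpha> < 1 / \<theta>" using assms by (simp add: frac_less2)
  ultimately show "0 < (\<integral>v. q v \<partial>lborel)" by simp
qed

text \<open>Homogeneity: replacing v by u * v factors u^(\<epsilon>-1) out of both the signed and
  the absolute integral, so both are multiples of the kernel of order \<epsilon>. The identity with
  \<open>D\<close> supplies absolute integrability for Fubini. At \<epsilon> = 0 the signed constant
  would vanish, while the absolute integral would be a multiple of 1/u, not integrable at 0.\<close>

lemma marchaud_kernel:
  fixes \<alpha> \<epsilon> :: real
  assumes "0 < \<epsilon>" "\<epsilon> < \<alpha>" "\<alpha> < 1"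
  defines "w \<equiv> \<lambda>v. indicator {0<..} v * v powr (-1-(\<alpha>-\<epsilon>))"
  obtains C D where "0 < C"
    and "\<And>u. integrable lborel (\<lambda>v. w v * (frac_kernel \<alpha> u - frac_kernel \<alpha> (u - v)))"
    and "\<And>u. (\<integral>v. w v * (frac_kernel \<alpha> u - frac_kernel \<alpha> (u - v)) \<partial>lborel) = C * frac_kernel \<epsilon> u"
    and "\<And>u. (\<integral>v. \<bar>w v * (frac_kernel \<alpha> u - frac_kernel \<alpha> (u - v))\<bar> \<partial>lborel) = D * frac_kernel \<epsilon> u"
proof -
  define q :: "real \<Rightarrow> real" where "q v = indicator {0<..} v * (v powr (-1-(\<alpha>-\<epsilon>)) * (1 - (if v < 1 then (1 - v) powr (\<alpha> - 1) else 0)))" for v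
  have q: "integrable lborel q" "0 < (\<integral>v. q v \<partial>lborel)"
    unfolding q_def using marchaud_constant_pos[of "\<alpha>-\<epsilon>" \<alpha>] assms by auto
  have G: "0 < Gamma \<alpha>" "0 < Gamma \<epsilon>" using assms by (auto intro: Gamma_real_pos)
  have scale: "w (0 + u * v) * (frac_kernel \<alpha> u - frac_kernel \<alpha> (u - (0 + u * v))) = u powr (\<epsilon> - 2) / Gamma \<alpha> * q v"
    if "0 < u" for u v
  proof (cases "0 < v")
    case True
    have eq: "u - u * v = u * (1 - v)" by (simp add: algebra_simps)
    have p: "u powr (-1-(\<alpha>-\<epsilon>)) * u powr (\<alpha> - 1) = u powr (\<epsilon> - 2)"
      by (simp flip: powr_add)
    have "w (u * v) * (frac_kernel \<alpha> u - frac_kernel \<alpha> (u * (1 - v)))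
       = u powr (-1-(\<alpha>-\<epsilon>)) * u powr (\<alpha> - 1) / Gamma \<alpha> * q v"
      using True that G
      by (auto simp: w_def q_def frac_kernel_def powr_mult zero_less_mult_iff divide_simps)
        (simp_all add: right_diff_distrib)
    then show ?thesis unfolding p eq by (simp add: eq)
  next
    case False
    then have "u * v \<le> 0" using that by (simp add: mult_nonneg_nonpos)
    with False show ?thesis by (simp add: w_def q_def)
  qed
  have zero: "w v * (frac_kernel \<alpha> u - frac_kernel \<alpha> (u - v)) = 0" if "u \<le> 0" for u v
    using that by (simp add: w_def frac_kernel_def indicator_def)
  have pw: "u * (u powr (\<epsilon> - 2) / Gamma \<alpha>) = Gamma \<epsilon> / Gamma \<alpha> * frac_kernel \<epsilon> u" if "0 < u" for u
    using that G powr_add[of u 1 "\<epsilon> - 2"] by (simp add: frac_kernel_def)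
  show thesis
  proof
    show "0 < Gamma \<epsilon> / Gamma \<alpha> * (\<integral>v. q v \<partial>lborel)" using q G by simp
    fix u :: real
    show "integrable lborel (\<lambda>v. w v * (frac_kernel \<alpha> u - frac_kernel \<alpha> (u - v)))"
    proof (cases "0 < u")
      case True
      have "integrable lborel (\<lambda>v. w (0 + u * v) * (frac_kernel \<alpha> u - frac_kernel \<alpha> (u - (0 + u * v))))"
        unfolding scale[OF True] using q by simp
      with True show ?thesis by (subst (asm) lborel_integrable_real_affine_iff) auto
    next
      case False
      then show ?thesis by (simp add: zero)
    qed
    show "(\<integral>v. w v * (frac_kernel \<alpha> u - frac_kernel \<alpha> (u - v)) \<partial>lborel)
       = Gamma \<epsilon> / Gamma \<alpha> * (\<integral>v. q v \<partial>lborel) * frac_kernel \<epsilon> u"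
    proof (cases "0 < u")
      case True
      have "(\<integral>v. w v * (frac_kernel \<alpha> u - frac_kernel \<alpha> (u - v)) \<partial>lborel)
         = u * (u powr (\<epsilon> - 2) / Gamma \<alpha>) * (\<integral>v. q v \<partial>lborel)"
        using True by (subst lborel_integral_real_affine[where c=u and t=0], simp, simp only: scale[OF True]) simp
      then show ?thesis unfolding pw[OF True] by (simp add: mult_ac)
    next
      case False
      then have "frac_kernel \<epsilon> u = 0" by (simp add: frac_kernel_def)
      with False show ?thesis by (simp add: zero)
    qed
    show "(\<integral>v. \<bar>w v * (frac_kernel \<alpha> u - frac_kernel \<alpha> (u - v))\<bar> \<partial>lborel)
       = Gamma \<epsilon> / Gamma \<alpha> * (\<integral>v. \<bar>q v\<bar> \<partial>lborel) * frac_kernel \<epsilon> u"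
    proof (cases "0 < u")
      case True
      have "(\<integral>v. \<bar>w v * (frac_kernel \<alpha> u - frac_kernel \<alpha> (u - v))\<bar> \<partial>lborel)
         = u * (u powr (\<epsilon> - 2) / Gamma \<alpha>) * (\<integral>v. \<bar>q v\<bar> \<partial>lborel)"
        using True G by (subst lborel_integral_real_affine[where c=u and t=0], simp, simp only: scale[OF True])
          (simp add: abs_mult)
      then show ?thesis unfolding pw[OF True] by (simp add: mult_ac)
    next
      case False
      then have "frac_kernel \<epsilon> u = 0" by (simp add: frac_kernel_def)
      with False show ?thesis by (simp add: zero)
    qed
  qed
qed

text \<open>Let \<open>H\<close> be the fractional integral of order \<open>\<alpha>\<close> of \<open>\<psi>\<close>.  With \<open>w v = v powr (-1-(\<alpha>-\<epsilon>))\<close>, Fubini turns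
  \<open>\<integral> w v * (H \<tau> - H (\<tau> - v)) dv\<close>, which is nonpositive, into a positive multiple of the
  fractional integral of order \<open>\<epsilon>\<close> of \<open>\<psi>\<close>.\<close>

lemma frac_integral_nonpos_at_minimum:
  fixes \<psi> :: "real \<Rightarrow> real"
  assumes "0 < \<epsilon>" "\<epsilon> < \<alpha>" "\<alpha> < 1"
    and [measurable]: "\<psi> \<in> borel_measurable borel"
    and int_\<alpha>: "integrable lborel (\<lambda>s. frac_kernel \<alpha> (\<tau> - s) * \<psi> s)"
    and int_\<epsilon>: "integrable lborel (\<lambda>s. frac_kernel \<epsilon> (\<tau> - s) * \<psi> s)"
    and min: "AE t in lborel. t < \<tau> \<longrightarrow> (\<integral>s. frac_kernel \<alpha> (\<tau> - s) * \<psi> s \<partial>lborel) \<le> (\<integral>s. frac_kernel \<alpha> (t - s) * \<psi> s \<partial>lborel)"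
  shows "(\<integral>s. frac_kernel \<epsilon> (\<tau> - s) * \<psi> s \<partial>lborel) \<le> 0"
proof -
  define w where "w = (\<lambda>v::real. indicator {0<..} v * v powr (-1-(\<alpha>-\<epsilon>)))"
  obtain C D where C: "0 < C"
    and ker_int: "\<And>u. integrable lborel (\<lambda>v. w v * (frac_kernel \<alpha> u - frac_kernel \<alpha> (u - v)))"
    and ker_eq: "\<And>u. (\<integral>v. w v * (frac_kernel \<alpha> u - frac_kernel \<alpha> (u - v)) \<partial>lborel) = C * frac_kernel \<epsilon> u"
    and ker_abs: "\<And>u. (\<integral>v. \<bar>w v * (frac_kernel \<alpha> u - frac_kernel \<alpha> (u - v))\<bar> \<partial>lborel) = D * frac_kernel \<epsilon> u"
    by (rule marchaud_kernel[OF assms(1-3)]) (rule that, unfold w_def, assumption+)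
  have [measurable]: "w \<in> borel_measurable borel" unfolding w_def by measurable
  define F where "F = (\<lambda>v s. w v * (frac_kernel \<alpha> (\<tau> - s) - frac_kernel \<alpha> (\<tau> - s - v)) * \<psi> s)"
  have F_meas: "case_prod F \<in> borel_measurable (borel \<Otimes>\<^sub>M borel)"
    unfolding F_def by measurable
  have inner: "integrable lborel (\<lambda>v. F v s)" for s
    unfolding F_def using ker_int by simp
  have "(\<integral>v. \<bar>F v s\<bar> \<partial>lborel) = D * frac_kernel \<epsilon> (\<tau> - s) * \<bar>\<psi> s\<bar>" for s
    unfolding F_def by (subst abs_mult) (simp add: ker_abs)
  moreover have "D * frac_kernel \<epsilon> (\<tau> - s) * \<bar>\<psi> s\<bar> = D * \<bar>frac_kernel \<epsilon> (\<tau> - s) * \<psi> s\<bar>" for s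
    using assms by (simp add: abs_mult frac_kernel_nonneg)
  ultimately have outer: "integrable lborel (\<lambda>s. \<integral>v. \<bar>F v s\<bar> \<partial>lborel)"
    using int_\<epsilon> by simp
  note swap = Fubini_swap[OF F_meas AE_I2[OF inner] outer]
  \<comment> \<open>The minimum condition in t becomes one in the lag v = \<tau> - t; reflection and
    translation preserve null sets.\<close>
  have "AE v in lborel. \<tau> + (-1) * v < \<tau> \<longrightarrow> (\<integral>s. frac_kernel \<alpha> (\<tau> - s) * \<psi> s \<partial>lborel)
      \<le> (\<integral>s. frac_kernel \<alpha> (\<tau> + (-1) * v - s) * \<psi> s \<partial>lborel)"
    by (rule AE_borel_affine[of "-1" _ \<tau>, OF _ _ min]) auto
  with swap(1) have neg: "AE v in lborel. (\<integral>s. F v s \<partial>lborel) \<le> 0"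
  proof eventually_elim
    case (elim v)
    show ?case
    proof (cases "0 < v")
      case False
      then have "F v s = 0" for s by (simp add: F_def w_def)
      then show ?thesis by simp
    next
      case True
      have w: "0 < w v" using True by (simp add: w_def)
      have F_alt: "F v = (\<lambda>s. w v * (frac_kernel \<alpha> (\<tau> - s) * \<psi> s - frac_kernel \<alpha> (\<tau> - v - s) * \<psi> s))"
        by (auto simp: F_def algebra_simps)
      \<comment> \<open>Convergence at the earlier time \<tau> - v is not assumed. Fubini gives it
        for almost every v, after subtracting from the convergent integral at
        \<open>\<tau>\<close>.\<close>
      have "integrable lborel (\<lambda>s. frac_kernel \<alpha> (\<tau> - s) * \<psi> s - frac_kernel \<alpha> (\<tau> - v - s) * \<psi> s)"
        using elim(1) w unfolding F_alt by simp
      from Bochner_Integration.integrable_diff[OF int_\<alpha> this]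
      have "integrable lborel (\<lambda>s. frac_kernel \<alpha> (\<tau> - v - s) * \<psi> s)" by simp
      then have "(\<integral>s. F v s \<partial>lborel) = w v * ((\<integral>s. frac_kernel \<alpha> (\<tau> - s) * \<psi> s \<partial>lborel)
           - (\<integral>s. frac_kernel \<alpha> (\<tau> - v - s) * \<psi> s \<partial>lborel))"
        unfolding F_alt using int_\<alpha> by simp
      with elim(2) True w show ?thesis by (simp add: mult_nonneg_nonpos)
    qed
  qed
  have "(\<integral>v. F v s \<partial>lborel) = C * (frac_kernel \<epsilon> (\<tau> - s) * \<psi> s)" for s
    unfolding F_def by (simp add: ker_eq)
  then have "C * (\<integral>s. frac_kernel \<epsilon> (\<tau> - s) * \<psi> s \<partial>lborel) = (\<integral>v. \<integral>s. F v s \<partial>lborel \<partial>lborel)"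
    using swap(3) by simp
  also have "\<dots> \<le> 0"
    using integral_nonneg_AE[where M=lborel and f="\<lambda>v. - (\<integral>s. F v s \<partial>lborel)"] neg by simp
  finally show ?thesis using C by (simp add: mult_le_0_iff)
qed

section \<open>Left density points\<close>

text \<open>Layer-cake argument: the superlevel sets of the decreasing weight are intervals \<open>(0, h)\<close>.\<close>

lemma integral_powr_weight_nonneg:
  fixes \<phi> :: "real \<Rightarrow> real"
  assumes "\<epsilon> < 1" and [measurable]: "\<phi> \<in> borel_measurable borel"
    and int: "integrable lborel (\<lambda>u. indicator {0<..<\<eta>} u * u powr (\<epsilon> - 1) * \<phi> u)"
    and nonneg: "\<And>h. 0 < h \<Longrightarrow> h \<le> \<eta> \<Longrightarrow> 0 \<le> (\<integral>u. indicator {0<..<h} u * \<phi> u \<partial>lborel)"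
  shows "0 \<le> (\<integral>u. indicator {0<..<\<eta>} u * u powr (\<epsilon> - 1) * \<phi> u \<partial>lborel)"
proof (cases "0 < \<eta>")
  case False
  then show ?thesis by simp
next
  case \<eta>: True
  \<comment> \<open>The weight u^(\<epsilon>-1) is expanded as the length of the interval (0,
    u^(\<epsilon>-1)) in the level variable z.\<close>
  define F :: "real \<Rightarrow> real \<Rightarrow> real" where
    "F z u = (indicator {0<..<\<eta>} u * \<phi> u) * indicator {0<..<u powr (\<epsilon> - 1)} z" for z u
  have "F = (\<lambda>z u. indicator {0<..<\<eta>} u * \<phi> u * (if 0 < z \<and> z < u powr (\<epsilon> - 1) then 1 else 0))"
    by (auto simp: F_def fun_eq_iff)
  then have F_meas: "case_prod F \<in> borel_measurable (borel \<Otimes>\<^sub>M borel)"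
    by simp
  have inner: "integrable lborel (\<lambda>z. F z u)" for u
    unfolding F_def by (intro integrable_mult_right) simp
  have F_int: "(\<integral>z. F z u \<partial>lborel) = indicator {0<..<\<eta>} u * u powr (\<epsilon> - 1) * \<phi> u" for u
    unfolding F_def by simp
  have "\<bar>F z u\<bar> = \<bar>indicator {0<..<\<eta>} u * \<phi> u\<bar> * indicator {0<..<u powr (\<epsilon> - 1)} z" for z u
    unfolding F_def by (simp add: abs_mult)
  then have "(\<integral>z. \<bar>F z u\<bar> \<partial>lborel) = \<bar>indicator {0<..<\<eta>} u * u powr (\<epsilon> - 1) * \<phi> u\<bar>" for u
    by (simp add: abs_mult)
  then have outer: "integrable lborel (\<lambda>u. \<integral>z. \<bar>F z u\<bar> \<partial>lborel)"
    using integrable_abs[OF int] by simp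
  note swap = Fubini_swap[OF F_meas AE_I2[OF inner] outer]
  have "0 \<le> (\<integral>u. F z u \<partial>lborel)" for z
  proof (cases "0 < z")
    case False
    then show ?thesis by (simp add: F_def)
  next
    case z: True
    define p where "p = 1 / (\<epsilon> - 1)"
    have p: "p < 0" using assms by (simp add: p_def)
    have iff: "z < u powr (\<epsilon> - 1) \<longleftrightarrow> u < z powr p" if "0 < u" for u
    proof
      assume "z < u powr (\<epsilon> - 1)"
      from powr_less_mono2_neg[OF p z this] show "u < z powr p"
        using that assms by (simp add: powr_powr p_def)
    next
      assume "u < z powr p"
      from powr_less_mono2_neg[OF _ that this, of "\<epsilon> - 1"] show "z < u powr (\<epsilon> - 1)"
        using z assms by (simp add: powr_powr p_def)
    qed
    have "F z u = indicator {0<..<min \<eta> (z powr p)} u * \<phi> u" for u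
      using iff[of u] z by (auto simp: F_def indicator_def)
    then show ?thesis using nonneg[of "min \<eta> (z powr p)"] \<eta> z by simp
  qed
  then have "0 \<le> (\<integral>z. \<integral>u. F z u \<partial>lborel \<partial>lborel)" by simp
  also have "\<dots> = (\<integral>u. indicator {0<..<\<eta>} u * u powr (\<epsilon> - 1) * \<phi> u \<partial>lborel)"
    using swap(3) by (simp add: F_int)
  finally show ?thesis .
qed

lemma powr_weight_integral:
  fixes \<epsilon> \<eta> :: real
  assumes "0 < \<epsilon>" "0 < \<eta>"
  shows "has_bochner_integral lborel (\<lambda>u. indicator {0<..<\<eta>} u * u powr (\<epsilon> - 1)) (\<eta> powr \<epsilon> / \<epsilon>)"
proof (rule has_bochner_integral_nn_integral)
  have "((\<lambda>u. u powr (\<epsilon> - 1)) has_integral (\<eta> powr \<epsilon> / \<epsilon>)) {0<..<\<eta>}"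
    using has_integral_powr_from_0[of "\<epsilon> - 1" \<eta>] assms by (simp add: has_integral_Icc_iff_Ioo)
  then show "(\<integral>\<^sup>+u. ennreal (indicator {0<..<\<eta>} u * u powr (\<epsilon> - 1)) \<partial>lborel) = ennreal (\<eta> powr \<epsilon> / \<epsilon>)"
    by (intro nn_integral_has_integral_lebesgue) auto
qed (use assms in auto)

text \<open>If L were positive, the averages near 0 would exceed m = L / 2, and the weight
  u^(\<epsilon>-1) would pick up a contribution of size m/\<epsilon> there, against a bounded one
  from the rest. Averages over (0, h) are enough because the weight is decreasing; no Lebesgue point
  is required.\<close>

lemma left_density_nonpos:
  fixes \<psi> :: "real \<Rightarrow> real" and \<epsilon> :: "nat \<Rightarrow> real"
  assumes \<psi>: "integrable lborel \<psi>"
    and lim: "((\<lambda>h. (\<integral>u. indicator {0<..<h} u * \<psi> (\<tau> - u) \<partial>lborel) / h) \<longlongrightarrow> L) (at_right 0)"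
    and \<epsilon>: "\<And>n. 0 < \<epsilon> n" "\<And>n. \<epsilon> n < 1" "\<epsilon> \<longlonglongrightarrow> 0"
    and int: "\<And>n. integrable lborel (\<lambda>s. frac_kernel (\<epsilon> n) (\<tau> - s) * \<psi> s)"
    and le: "\<And>n. (\<integral>s. frac_kernel (\<epsilon> n) (\<tau> - s) * \<psi> s \<partial>lborel) \<le> 0"
  shows "L \<le> 0"
proof (rule ccontr)
  assume "\<not> L \<le> 0"
  define m where "m = L / 2"
  have m: "0 < m" "m < L" using \<open>\<not> L \<le> 0\<close> by (auto simp: m_def)
  define \<phi> where "\<phi> u = \<psi> (\<tau> - u)" for u
  have \<phi>: "integrable lborel \<phi>"
    unfolding \<phi>_def using lborel_integrable_real_affine[OF \<psi>, of "-1" \<tau>] by simp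
  then have [measurable]: "\<phi> \<in> borel_measurable borel" by auto
  from order_tendstoD(1)[OF lim m(2)] obtain \<eta>0 where \<eta>0: "0 < \<eta>0"
    "\<And>h. 0 < h \<Longrightarrow> h < \<eta>0 \<Longrightarrow> m < (\<integral>u. indicator {0<..<h} u * \<phi> u \<partial>lborel) / h"
    unfolding eventually_at_right_field \<phi>_def by auto
  \<comment> \<open>Halving makes the average bound available up to and including h =
    \<eta>.\<close>
  define \<eta> where "\<eta> = \<eta>0 / 2"
  have \<eta>: "0 < \<eta>" using \<eta>0 by (simp add: \<eta>_def)
  have int_h: "integrable lborel (\<lambda>u. indicator {0<..<h} u * \<phi> u)" for h
    using integrable_mult_indicator[OF _ \<phi>, of "{0<..<h}"] by simp
  have avg: "0 \<le> (\<integral>u. indicator {0<..<h} u * (\<phi> u - m) \<partial>lborel)" if "0 < h" "h \<le> \<eta>" for h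
  proof -
    have "(\<integral>u. indicator {0<..<h} u * (\<phi> u - m) \<partial>lborel)
       = (\<integral>u. indicator {0<..<h} u * \<phi> u \<partial>lborel) - m * h"
      using int_h[of h] that by (simp add: right_diff_distrib)
    moreover have "m < (\<integral>u. indicator {0<..<h} u * \<phi> u \<partial>lborel) / h"
      using \<eta>0 that by (simp add: \<eta>_def)
    ultimately show ?thesis using that by (simp add: field_simps)
  qed
  define N where "N = (\<integral>u. \<bar>\<phi> u\<bar> \<partial>lborel)"
  \<comment> \<open>The weight has mass \<eta>^\<epsilon> / \<epsilon> on (0, \<eta>) and is at most
    \<eta>^(\<epsilon>-1) beyond. Since near and far parts add up to something nonpositive, dividing
    by \<eta>^(\<epsilon>-1) leaves this inequality, which fails as \<epsilon> tends to 0.\<close>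
  have bound: "m * \<eta> \<le> \<epsilon> n * N" for n
  proof -
    define e where "e = \<epsilon> n"
    have e: "0 < e" "e < 1" using \<epsilon> by (auto simp: e_def)
    have G: "0 < Gamma e" using e by (simp add: Gamma_real_pos)
    have ker: "frac_kernel e u = indicator {0<..} u * u powr (e - 1) / Gamma e" for u
      by (simp add: frac_kernel_def)
    \<comment> \<open>Multiplying by Gamma \<epsilon> removes the normalisation without affecting
      the sign.\<close>
    define w where "w u = indicator {0<..} u * u powr (e - 1) * \<phi> u" for u :: real
    have w_alt: "w u = Gamma e * (frac_kernel e (\<tau> - (\<tau> + (-1) * u)) * \<psi> (\<tau> + (-1) * u))" for u
      unfolding w_def \<phi>_def ker using G by simp
    have w_int: "integrable lborel w"
      unfolding w_alt using lborel_integrable_real_affine[OF int[of n], of "-1" \<tau>]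
      by (intro integrable_mult_right) (simp add: e_def)
    have "(\<integral>u. w u \<partial>lborel) = Gamma e * (\<integral>s. frac_kernel e (\<tau> - s) * \<psi> s \<partial>lborel)"
      unfolding w_alt by (subst (2) lborel_integral_real_affine[where c="-1" and t=\<tau>]) simp_all
    then have w_le: "(\<integral>u. w u \<partial>lborel) \<le> 0"
      using le[of n] G by (simp add: e_def mult_nonneg_nonpos)
    have near_eq: "indicator {0<..<\<eta>} u * w u = indicator {0<..<\<eta>} u * u powr (e - 1) * \<phi> u" for u
      by (simp add: w_def indicator_def)
    have near_int: "integrable lborel (\<lambda>u. indicator {0<..<\<eta>} u * w u)"
      using integrable_mult_indicator[OF _ w_int, of "{0<..<\<eta>}"] by simp
    have far_int: "integrable lborel (\<lambda>u. indicator {\<eta>..} u * w u)"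
      using integrable_mult_indicator[OF _ w_int, of "{\<eta>..}"] by simp
    note pw = powr_weight_integral[OF e(1) \<eta>, unfolded has_bochner_integral_iff]
    have diff: "indicator {0<..<\<eta>} u * u powr (e - 1) * (\<phi> u - m)
       = indicator {0<..<\<eta>} u * w u - m * (indicator {0<..<\<eta>} u * u powr (e - 1))" for u
      unfolding near_eq by (simp add: algebra_simps)
    have "0 \<le> (\<integral>u. indicator {0<..<\<eta>} u * u powr (e - 1) * (\<phi> u - m) \<partial>lborel)"
      using avg near_int pw
      by (intro integral_powr_weight_nonneg e) (auto simp: diff)
    also have "\<dots> = (\<integral>u. indicator {0<..<\<eta>} u * w u \<partial>lborel) - m * (\<eta> powr e / e)"
      unfolding diff using near_int pw by simp
    finally have near: "m * (\<eta> powr e / e) \<le> (\<integral>u. indicator {0<..<\<eta>} u * w u \<partial>lborel)" by simp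
    have "- (\<eta> powr (e - 1) * N) = (\<integral>u. - (\<eta> powr (e - 1) * \<bar>\<phi> u\<bar>) \<partial>lborel)"
      by (simp add: N_def)
    also have "\<dots> \<le> (\<integral>u. indicator {\<eta>..} u * w u \<partial>lborel)"
    proof (rule integral_mono)
      show "integrable lborel (\<lambda>u. - (\<eta> powr (e - 1) * \<bar>\<phi> u\<bar>))" using \<phi> by simp
      fix u
      show "- (\<eta> powr (e - 1) * \<bar>\<phi> u\<bar>) \<le> indicator {\<eta>..} u * w u"
      proof (cases "\<eta> \<le> u")
        case True
        have "u powr (e - 1) * \<bar>\<phi> u\<bar> \<le> \<eta> powr (e - 1) * \<bar>\<phi> u\<bar>"
          using True \<eta> e by (intro mult_right_mono powr_mono2') auto
        moreover have "- (u powr (e - 1) * \<bar>\<phi> u\<bar>) \<le> u powr (e - 1) * \<phi> u"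
          by (simp add: abs_if)
        ultimately show ?thesis using True \<eta> by (simp add: w_def)
      qed simp
    qed (rule far_int)
    finally have far: "- (\<eta> powr (e - 1) * N) \<le> (\<integral>u. indicator {\<eta>..} u * w u \<partial>lborel)" .
    have "w u = indicator {0<..<\<eta>} u * w u + indicator {\<eta>..} u * w u" for u
      using \<eta> by (auto simp: w_def indicator_def)
    then have "(\<integral>u. w u \<partial>lborel) = (\<integral>u. indicator {0<..<\<eta>} u * w u + indicator {\<eta>..} u * w u \<partial>lborel)"
      by metis
    also have "\<dots> = (\<integral>u. indicator {0<..<\<eta>} u * w u \<partial>lborel) + (\<integral>u. indicator {\<eta>..} u * w u \<partial>lborel)"
      using near_int far_int by simp
    finally have "m * (\<eta> powr e / e) \<le> \<eta> powr (e - 1) * N"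
      using near far w_le by simp
    also have "\<eta> powr e = \<eta> powr (e - 1) * \<eta>"
      using \<eta> powr_add[of \<eta> "e - 1" 1] by simp
    finally have "\<eta> powr (e - 1) * (m * \<eta> / e) \<le> \<eta> powr (e - 1) * N" by (simp add: mult_ac)
    then have "m * \<eta> / e \<le> N"
      by (rule mult_left_le_imp_le) (use \<eta> in simp)
    then show ?thesis using e by (simp add: field_simps e_def)
  qed
  have "(\<lambda>n. \<epsilon> n * N) \<longlonglongrightarrow> 0 * N" using \<epsilon> by (intro tendsto_intros)
  then have "m * \<eta> \<le> 0 * N" using bound by (intro LIMSEQ_le_const) auto
  with m \<eta> show False by (simp add: mult_le_0_iff)
qed

text \<open>The library theorem averages over \<open>[x, x + h]\<close>; the reflection gives averages to the left.\<close>

lemma AE_left_density: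
  fixes \<psi> :: "real \<Rightarrow> real"
  assumes \<psi>: "integrable lborel \<psi>"
  shows "AE \<tau> in lborel. ((\<lambda>h. (\<integral>u. indicator {0<..<h} u * \<psi> (\<tau> - u) \<partial>lborel) / h) \<longlongrightarrow> \<psi> \<tau>) (at_right 0)"
proof -
  define \<phi> where "\<phi> x = \<psi> (- x)" for x
  have \<phi>: "integrable lborel \<phi>"
    unfolding \<phi>_def using lborel_integrable_real_affine[OF \<psi>, of "-1" 0] by simp
  have \<phi>_set: "set_integrable lborel A \<phi>" if "A \<in> sets borel" for A
    unfolding set_integrable_def using that by (intro integrable_mult_indicator \<phi>) auto
  have "\<phi> integrable_on cbox a b" for a b
    using set_borel_integral_eq_integral(1)[OF \<phi>_set, of "cbox a b"] by simp
  from integrable_ccontinuous_explicit[OF this] obtain N where N: "negligible N"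
    and lim: "\<And>x e. x \<notin> N \<Longrightarrow> 0 < e \<Longrightarrow> \<exists>d>0. \<forall>h. 0 < h \<and> h < d \<longrightarrow>
      norm (integral (cbox x (x + h *\<^sub>R One)) \<phi> /\<^sub>R h ^ DIM(real) - \<phi> x) < e"
    by metis
  have eq: "integral (cbox (-\<tau>) (-\<tau> + h *\<^sub>R One)) \<phi> /\<^sub>R h ^ DIM(real)
     = (\<integral>u. indicator {0<..<h} u * \<psi> (\<tau> - u) \<partial>lborel) / h" if "0 < h" for \<tau> h
  proof -
    have "integral (cbox (-\<tau>) (-\<tau> + h *\<^sub>R One)) \<phi> = (LINT x:{-\<tau>..-\<tau>+h}|lborel. \<phi> x)"
      using set_borel_integral_eq_integral(2)[OF \<phi>_set, of "{-\<tau>..-\<tau>+h}"] by simp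
    also have "\<dots> = (\<integral>u. indicator {-\<tau>..-\<tau>+h} (-\<tau> + 1 * u) * \<phi> (-\<tau> + 1 * u) \<partial>lborel)"
      unfolding set_lebesgue_integral_def
      by (subst lborel_integral_real_affine[where c=1 and t="-\<tau>"]) simp_all
    also have "\<dots> = (\<integral>u. indicator {0..h} u * \<psi> (\<tau> - u) \<partial>lborel)"
      by (intro Bochner_Integration.integral_cong) (auto simp: indicator_def \<phi>_def)
    also have "\<dots> = (\<integral>u. indicator {0<..<h} u * \<psi> (\<tau> - u) \<partial>lborel)"
    proof (rule integral_cong_AE)
      have [measurable]: "\<psi> \<in> borel_measurable borel" using \<psi> by auto
      show "(\<lambda>u. indicator {0..h} u * \<psi> (\<tau> - u)) \<in> borel_measurable lborel" by measurable
      show "(\<lambda>u. indicator {0<..<h} u * \<psi> (\<tau> - u)) \<in> borel_measurable lborel" by measurable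
      show "AE u in lborel. indicator {0..h} u * \<psi> (\<tau> - u) = indicator {0<..<h} u * \<psi> (\<tau> - u)"
        using AE_lborel_singleton[of 0] AE_lborel_singleton[of h]
        by eventually_elim (auto simp: indicator_def)
    qed
    finally show ?thesis by (simp add: field_simps)
  qed
  have tend: "((\<lambda>h. (\<integral>u. indicator {0<..<h} u * \<psi> (\<tau> - u) \<partial>lborel) / h) \<longlongrightarrow> \<psi> \<tau>) (at_right 0)"
    if "- \<tau> \<notin> N" for \<tau>
  proof (rule tendstoI)
    fix e :: real assume "0 < e"
    from lim[OF that this] obtain d where d: "0 < d" "\<And>h. 0 < h \<Longrightarrow> h < d \<Longrightarrow>
      norm (integral (cbox (-\<tau>) (-\<tau> + h *\<^sub>R One)) \<phi> /\<^sub>R h ^ DIM(real) - \<phi> (-\<tau>)) < e"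
      by blast
    show "eventually (\<lambda>h. dist ((\<integral>u. indicator {0<..<h} u * \<psi> (\<tau> - u) \<partial>lborel) / h) (\<psi> \<tau>) < e) (at_right 0)"
      unfolding eventually_at_right_field
    proof (intro exI[of _ d] conjI allI impI d(1))
      fix h assume "0 < h" "h < d"
      with d(2)[of h] show "dist ((\<integral>u. indicator {0<..<h} u * \<psi> (\<tau> - u) \<partial>lborel) / h) (\<psi> \<tau>) < e"
        unfolding eq[OF \<open>0 < h\<close>] dist_norm by (simp add: \<phi>_def)
    qed
  qed
  have "AE x in lebesgue. x \<notin> N"
    using N by (simp add: negligible_iff_null_sets AE_not_in)
  then have "AE x in lborel. x \<notin> N"
    by (simp add: AE_completion_iff)
  \<comment> \<open>The exceptional set is only Lebesgue null; a Borel null superset is taken so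
    that it can be reflected.\<close>
  then obtain M where M: "M \<in> null_sets lborel" "N \<subseteq> M"
    by (auto elim!: AE_E simp: null_sets_def)
  then have "AE x in lborel. x \<notin> M" by (intro AE_not_in)
  then have "AE x in lborel. 0 + (-1) * x \<notin> M"
    using M by (intro AE_borel_affine) auto
  then show ?thesis
    by eventually_elim (use M tend in auto)
qed

section \<open>Smooth cut-off functions\<close>

text \<open>The classical flat function e^(-1/x), with a polynomial in 1/x as prefactor so that the
  family is closed under differentiation.\<close>

definition flat_exp :: "real poly \<Rightarrow> real \<Rightarrow> real" where
  "flat_exp p x = (if x > 0 then poly p (1 / x) * exp (- (1 / x)) else 0)"

text \<open>The factor \<open>y ^ k\<close> strengthens the induction: peeling off a coefficient of
  the polynomial raises \<open>k\<close> by one.\<close>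

lemma tendsto_poly_times_exp_neg:
  "((\<lambda>y::real. y ^ k * poly p y / exp y) \<longlongrightarrow> 0) at_top"
proof (induction p arbitrary: k)
  case 0
  then show ?case by simp
next
  case (pCons a p)
  have "((\<lambda>y::real. a * (y ^ k / exp y) + y ^ Suc k * poly p y / exp y) \<longlongrightarrow> a * 0 + 0) at_top"
    by (intro tendsto_intros tendsto_power_div_exp_0 pCons.IH)
  then show ?case by (simp add: algebra_simps add_divide_distrib)
qed

text \<open>With y = 1/x, the derivative of p(y) e^(-y) in y is (p' - p)(y) e^(-y), and dy/dx =
  -y^2; hence the polynomial y^2 (p - p'). At the origin exponential decay beats every
  polynomial.\<close>

lemma DERIV_flat_exp:
  "(flat_exp p has_real_derivative flat_exp ([:0, 0, 1:] * (p - pderiv p)) x) (at x)"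
proof -
  consider "x < 0" | "x > 0" | "x = 0" by linarith
  then show ?thesis
  proof cases
    case 1
    have "((\<lambda>_. 0) has_real_derivative 0) (at x)" by simp
    then have "(flat_exp p has_real_derivative 0) (at x)"
      by (rule has_field_derivative_transform_within_open[where S="{..<0}"])
        (use 1 in \<open>auto simp: flat_exp_def\<close>)
    then show ?thesis using 1 by (simp add: flat_exp_def)
  next
    case 2
    have "((\<lambda>x. poly p (1 / x) * exp (- (1 / x))) has_real_derivative
        (poly (pderiv p) (1 / x) * (- 1 / x\<^sup>2)) * exp (- (1 / x)) + poly p (1 / x) * (exp (- (1 / x)) * (1 / x\<^sup>2))) (at x)"
      by (rule DERIV_mult DERIV_chain2[OF poly_DERIV] DERIV_chain2[OF DERIV_exp] derivative_eq_intros refl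
            | use 2 in \<open>simp add: power2_eq_square divide_simps\<close>)+
    also have "(poly (pderiv p) (1 / x) * (- 1 / x\<^sup>2)) * exp (- (1 / x)) + poly p (1 / x) * (exp (- (1 / x)) * (1 / x\<^sup>2))
       = flat_exp ([:0, 0, 1:] * (p - pderiv p)) x"
      using 2 by (simp add: flat_exp_def power2_eq_square field_simps)
    finally have "((\<lambda>x. poly p (1 / x) * exp (- (1 / x))) has_real_derivative flat_exp ([:0, 0, 1:] * (p - pderiv p)) x) (at x)" .
    then show ?thesis
      by (rule has_field_derivative_transform_within_open[where S="{0<..}"])
        (use 2 in \<open>auto simp: flat_exp_def\<close>)
  next
    case 3
    have lim_top: "((\<lambda>y::real. y ^ 1 * poly p y / exp y) \<longlongrightarrow> 0) at_top"
      by (rule tendsto_poly_times_exp_neg)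
    have "((\<lambda>h. inverse h ^ 1 * poly p (inverse h) / exp (inverse h)) \<longlongrightarrow> 0) (at_right 0)"
      by (rule filterlim_compose[OF lim_top filterlim_inverse_at_top_right])
    moreover have "eventually (\<lambda>h. inverse h ^ 1 * poly p (inverse h) / exp (inverse h) = (flat_exp p (0 + h) - flat_exp p 0) / h) (at_right 0)"
      unfolding eventually_at_right_field
      by (rule exI[of _ 1]) (auto simp: flat_exp_def exp_minus field_simps)
    ultimately have right: "((\<lambda>h. (flat_exp p (0 + h) - flat_exp p 0) / h) \<longlongrightarrow> 0) (at_right 0)"
      by (rule Lim_transform_eventually)
    have left: "((\<lambda>h. (flat_exp p (0 + h) - flat_exp p 0) / h) \<longlongrightarrow> 0) (at_left 0)"
      by (rule tendsto_eventually) (auto simp: flat_exp_def eventually_at_left_field intro!: exI[of _ "-1"])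
    from filterlim_split_at[OF left right] 3 show ?thesis
      by (simp add: DERIV_def flat_exp_def)
  qed
qed

text \<open>Test functions need every iterated \<open>deriv\<close> to be differentiable. A class
  stable under derivatives settles this by one induction, without formulas for higher
  derivatives.\<close>

inductive_set smooth_alg :: "(real \<Rightarrow> real) set" where
  flat: "(\<lambda>x. flat_exp p (c * x + d)) \<in> smooth_alg"
| const: "(\<lambda>x. c) \<in> smooth_alg"
| add: "f \<in> smooth_alg \<Longrightarrow> g \<in> smooth_alg \<Longrightarrow> (\<lambda>x. f x + g x) \<in> smooth_alg"
| mult: "f \<in> smooth_alg \<Longrightarrow> g \<in> smooth_alg \<Longrightarrow> (\<lambda>x. f x * g x) \<in> smooth_alg"

lemma smooth_alg_DERIV:
  assumes "f \<in> smooth_alg"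
  shows "\<exists>f'\<in>smooth_alg. \<forall>x. (f has_real_derivative f' x) (at x)"
  using assms
proof induction
  case (flat p c d)
  let ?q = "[:0, 0, 1:] * (p - pderiv p)"
  have "((\<lambda>x. flat_exp p (c * x + d)) has_real_derivative flat_exp ?q (c * x + d) * c) (at x)" for x
    by (rule DERIV_chain2[OF DERIV_flat_exp]) (auto intro!: derivative_eq_intros)
  moreover have "(\<lambda>x. flat_exp ?q (c * x + d) * c) \<in> smooth_alg"
    by (intro smooth_alg.intros)
  ultimately show ?case by (intro bexI[of _ "\<lambda>x. flat_exp ?q (c * x + d) * c"] allI)
next
  case (const c)
  show ?case by (intro bexI[of _ "\<lambda>x. 0"] allI smooth_alg.const) simp
next
  case (add f g)
  then obtain f' g' where "f' \<in> smooth_alg" "g' \<in> smooth_alg"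
    "\<And>x. (f has_real_derivative f' x) (at x)" "\<And>x. (g has_real_derivative g' x) (at x)" by blast
  then show ?case by (intro bexI[of _ "\<lambda>x. f' x + g' x"]) (auto intro: smooth_alg.intros DERIV_add)
next
  case (mult f g)
  then obtain f' g' where "f' \<in> smooth_alg" "g' \<in> smooth_alg"
    "\<And>x. (f has_real_derivative f' x) (at x)" "\<And>x. (g has_real_derivative g' x) (at x)" by blast
  with mult show ?case
    by (intro bexI[of _ "\<lambda>x. f' x * g x + g' x * f x"]) (auto intro: smooth_alg.intros DERIV_mult)
qed

lemma smooth_alg_deriv: "f \<in> smooth_alg \<Longrightarrow> deriv f \<in> smooth_alg"
  using smooth_alg_DERIV[of f] by (metis DERIV_imp_deriv ext)

lemma smooth_alg_higher_deriv: "f \<in> smooth_alg \<Longrightarrow> (deriv ^^ n) f \<in> smooth_alg"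
  by (induction n) (auto intro: smooth_alg_deriv)

lemma smooth_alg_differentiable: "f \<in> smooth_alg \<Longrightarrow> f differentiable_on UNIV"
  using smooth_alg_DERIV[of f] unfolding differentiable_on_def
  by (auto simp: real_differentiable_def)

lemma smooth_alg_continuous: "f \<in> smooth_alg \<Longrightarrow> continuous_on S f"
  by (meson smooth_alg_differentiable differentiable_imp_continuous_on continuous_on_subset subset_UNIV)

text \<open>Stretching by \<open>n\<close> pushes both flat factors to 1 at each interior point, so
  the bumps converge boundedly to the indicator of (l, u). Bumps over intervals of equal length are
  translates of each other.\<close>

definition bump :: "nat \<Rightarrow> real \<Rightarrow> real \<Rightarrow> real \<Rightarrow> real" where
  "bump n l u x = flat_exp 1 (real n * (x - l)) * flat_exp 1 (real n * (u - x))"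

lemma bump_smooth: "bump n l u \<in> smooth_alg"
proof -
  have "(\<lambda>x. flat_exp 1 (real n * x + - real n * l) * flat_exp 1 (- real n * x + real n * u)) \<in> smooth_alg"
    by (intro smooth_alg.intros)
  moreover have "bump n l u = (\<lambda>x. flat_exp 1 (real n * x + - real n * l) * flat_exp 1 (- real n * x + real n * u))"
    by (auto simp: bump_def fun_eq_iff algebra_simps)
  ultimately show ?thesis by simp
qed

lemma bump_eq_0: "x \<notin> {l<..<u} \<Longrightarrow> bump n l u x = 0"
  by (auto simp: bump_def flat_exp_def zero_less_mult_iff)

lemma bump_nonneg: "0 \<le> bump n l u x"
  by (auto simp: bump_def flat_exp_def)

lemma bump_le: "bump n l u x \<le> indicator {l<..<u} x"
proof (cases "x \<in> {l<..<u}")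
  case True
  have "flat_exp 1 y \<le> 1" "0 \<le> flat_exp 1 y" for y by (auto simp: flat_exp_def)
  then have "bump n l u x \<le> 1 * 1" unfolding bump_def by (intro mult_mono) auto
  with True show ?thesis by simp
qed (simp add: bump_eq_0)

lemma abs_bump_le_1: "\<bar>bump n l u x\<bar> \<le> 1"
  using bump_nonneg[of n l u x] order_trans[OF bump_le[of n l u x] indicator_le_1] by simp

lemma bump_tendsto: "(\<lambda>n. bump n l u x) \<longlonglongrightarrow> indicator {l<..<u} x"
proof (cases "x \<in> {l<..<u}")
  case True
  have flat: "(\<lambda>n. flat_exp 1 (real n * c)) \<longlonglongrightarrow> 1" if "0 < c" for c
  proof (rule Lim_transform_eventually)
    have "(\<lambda>n. exp (- (inverse (real n) * inverse c))) \<longlonglongrightarrow> exp (- (0 * inverse c))"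
      by (intro tendsto_intros lim_inverse_n)
    then show "(\<lambda>n. exp (- (inverse (real n) * inverse c))) \<longlonglongrightarrow> 1" by simp
    show "eventually (\<lambda>n. exp (- (inverse (real n) * inverse c)) = flat_exp 1 (real n * c)) sequentially"
      using eventually_gt_at_top[of 0]
      by eventually_elim (use that in \<open>auto simp: flat_exp_def field_simps\<close>)
  qed
  have "(\<lambda>n. bump n l u x) \<longlonglongrightarrow> 1 * 1"
    unfolding bump_def using True by (intro tendsto_mult flat) auto
  with True show ?thesis by simp
qed (simp add: bump_eq_0)

lemma bump_measurable [measurable]: "bump n l u \<in> borel_measurable borel"
  by (intro borel_measurable_continuous_onI smooth_alg_continuous bump_smooth)

lemma bump_integrable: "integrable lborel (bump n l u)"
proof (rule Bochner_Integration.integrable_bound)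
  show "integrable lborel (indicator {l<..<u} :: real \<Rightarrow> real)" by (cases "l \<le> u") auto
  show "AE x in lborel. norm (bump n l u x) \<le> norm (indicator {l<..<u} x :: real)"
    using bump_nonneg[of n l u] bump_le[of n l u] by simp
qed measurable

text \<open>The two bumps are translates, so their difference has mean zero and its primitive is
  constant, with the same value, on both sides of the supports. Subtracting that value leaves a
  compactly supported function.\<close>

lemma test_function_bump_diff:
  assumes h: "a < p - h" "p < b" "a < r - h" "r < b" and "0 < h"
  obtains \<psi> where "test_function a b \<psi>" and "\<And>x. deriv \<psi> x = bump n (p - h) p x - bump n (r - h) r x"
proof -
  define \<beta> where "\<beta> x = bump n (p - h) p x - bump n (r - h) r x" for x
  have "(\<lambda>x. bump n (p - h) p x + (-1) * bump n (r - h) r x) \<in> smooth_alg"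
    by (intro smooth_alg.intros bump_smooth)
  then have \<beta>: "\<beta> \<in> smooth_alg" by (simp add: \<beta>_def[abs_def])
  note \<beta>_cont = smooth_alg_continuous[OF \<beta>]
  define l where "l = min p r - h"
  define u where "u = max p r"
  have lu: "a < l" "l < u" "u < b" using assms by (auto simp: l_def u_def)
  have \<beta>0: "\<beta> x = 0" if "x \<le> l \<or> u \<le> x" for x
  proof -
    have "bump n (p - h) p x = 0" "bump n (r - h) r x = 0"
      by (rule bump_eq_0, use that in \<open>auto simp: l_def u_def\<close>)+
    then show ?thesis by (simp add: \<beta>_def)
  qed
  have "\<exists>F. \<forall>x :: real. -\<infinity> < ereal x \<longrightarrow> ereal x < \<infinity> \<longrightarrow> (F has_vector_derivative \<beta> x) (at x)"
    using \<beta>_cont[of UNIV] by (intro einterval_antiderivative) (auto simp: continuous_on_eq_continuous_at)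
  then obtain F where F: "\<And>x. (F has_real_derivative \<beta> x) (at x)"
    by (auto simp: has_real_derivative_iff_has_vector_derivative)
  have FTC: "(\<integral>x. indicator {c..d} x * \<beta> x \<partial>lborel) = F d - F c" if "c \<le> d" for c d
    using integral_FTC_atLeastAtMost[OF that, of F \<beta>] F \<beta>_cont
    by (auto simp: has_real_derivative_iff_has_vector_derivative intro: has_vector_derivative_at_within)
  have "bump n (p - h) p (p - r + 1 * x) = bump n (r - h) r x" for x
    unfolding bump_def by (rule arg_cong2[where f="(*)"]) (auto simp: algebra_simps)
  then have "(\<integral>x. bump n (p - h) p x \<partial>lborel) = (\<integral>x. bump n (r - h) r x \<partial>lborel)"
    by (subst lborel_integral_real_affine[where c=1 and t="p - r"]) simp_all
  then have tot: "(\<integral>x. \<beta> x \<partial>lborel) = 0"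
    unfolding \<beta>_def by (simp add: bump_integrable)
  have left: "F x = F l" if "x \<le> l" for x
  proof -
    have zero: "indicator {x..l} y * \<beta> y = 0" for y
      using \<beta>0 by (auto simp: indicator_def)
    show ?thesis using FTC[OF that] unfolding zero by simp
  qed
  have right: "F x = F l" if "u \<le> x" for x
  proof -
    have eq: "indicator {l..x} y * \<beta> y = \<beta> y" for y
      using \<beta>0[of y] that by (cases "y \<in> {l..x}") auto
    show ?thesis using FTC[of l x] tot lu that unfolding eq by simp
  qed
  define \<psi> where "\<psi> x = F x - F l" for x
  have der: "(\<psi> has_real_derivative \<beta> x) (at x)" for x
    unfolding \<psi>_def using F[of x] by (auto intro!: derivative_eq_intros)
  then have deriv: "deriv \<psi> = \<beta>" by (auto intro: DERIV_imp_deriv)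
  have "((deriv ^^ m) \<psi>) differentiable_on UNIV" for m
  proof (cases m)
    case 0
    then show ?thesis using der by (auto simp: differentiable_on_def real_differentiable_def)
  next
    case (Suc k)
    then have "(deriv ^^ m) \<psi> = (deriv ^^ k) \<beta>" by (simp add: funpow_Suc_right deriv del: funpow.simps)
    then show ?thesis using \<beta> by (simp add: smooth_alg_differentiable smooth_alg_higher_deriv)
  qed
  moreover have sub: "closure {x. \<psi> x \<noteq> 0} \<subseteq> {l..u}"
  proof (rule closure_minimal)
    show "{x. \<psi> x \<noteq> 0} \<subseteq> {l..u}"
    proof
      fix x assume "x \<in> {x. \<psi> x \<noteq> 0}"
      then show "x \<in> {l..u}" using left[of x] right[of x] by (cases "x \<le> l"; cases "u \<le> x") (auto simp: \<psi>_def)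
    qed
  qed simp
  moreover have "compact (closure {x. \<psi> x \<noteq> 0})"
    using compact_Int_closed[OF compact_Icc closed_closure, of l u "{x. \<psi> x \<noteq> 0}"] sub by (simp add: Int_absorb1)
  moreover have "closure {x. \<psi> x \<noteq> 0} \<subseteq> {a<..<b}"
    using sub lu by force
  ultimately have "test_function a b \<psi>" by (simp add: test_function_def)
  then show thesis using that deriv by (simp add: \<beta>_def)
qed

section \<open>Weak derivatives as indefinite integrals\<close>

text \<open>Weak derivatives are defined through \<open>lebesgue\<close>, whereas Fubini and affine
  substitution are applied over \<open>lborel\<close>. The representative carries statements across;
  its vanishing off the interval turns set integrals into plain ones.\<close>

lemma absolutely_integrable_borel_representative:
  fixes v :: "real \<Rightarrow> real"
  assumes "v absolutely_integrable_on {a<..<b}"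
  obtains v' where "integrable lborel v'" "\<And>x. x \<notin> {a<..<b} \<Longrightarrow> v' x = 0"
    "AE x in lborel. x \<in> {a<..<b} \<longrightarrow> v x = v' x"
    "\<And>g. g \<in> borel_measurable borel \<Longrightarrow>
      (LINT x:{a<..<b}|lebesgue. v x * g x) = (\<integral>x. v' x * g x \<partial>lborel)"
proof -
  have int: "integrable lebesgue (\<lambda>x. indicator {a<..<b} x * v x)"
    using assms by (simp add: set_integrable_def)
  then obtain w where w: "w \<in> borel_measurable lborel" "AE x in lborel. indicator {a<..<b} x * v x = w x"
    using completion_ex_borel_measurable_real[of "\<lambda>x. indicator {a<..<b} x * v x" lborel] by auto
  define v' where "v' x = indicator {a<..<b} x * w x" for x
  have [measurable]: "v' \<in> borel_measurable borel" unfolding v'_def using w by simp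
  have ae: "AE x in lborel. indicator {a<..<b} x * v x = v' x"
    using w(2)
  proof eventually_elim
    case (elim x)
    then show ?case by (cases "x \<in> {a<..<b}") (auto simp: v'_def)
  qed
  have v'_meas: "v' \<in> borel_measurable lebesgue" by (intro measurable_completion) simp
  have "integrable lebesgue v'"
    using int ae v'_meas by (subst integrable_cong_AE[of _ _ "\<lambda>x. indicator {a<..<b} x * v x"])
      (auto simp: AE_completion_iff elim: eventually_mono)
  then have "integrable lborel v'" by (subst (asm) integrable_completion) simp_all
  moreover have "v' x = 0" if "x \<notin> {a<..<b}" for x using that by (simp add: v'_def)
  moreover have "AE x in lborel. x \<in> {a<..<b} \<longrightarrow> v x = v' x"
    using ae by eventually_elim auto
  moreover have "(LINT x:{a<..<b}|lebesgue. v x * g x) = (\<integral>x. v' x * g x \<partial>lborel)"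
    if [measurable]: "g \<in> borel_measurable borel" for g
  proof -
    have g: "g \<in> borel_measurable lebesgue" by (intro measurable_completion) simp
    have "(LINT x:{a<..<b}|lebesgue. v x * g x) = (\<integral>x. (indicator {a<..<b} x * v x) * g x \<partial>lebesgue)"
      unfolding set_lebesgue_integral_def by (simp add: mult.assoc)
    also have "\<dots> = (\<integral>x. v' x * g x \<partial>lebesgue)"
    proof (rule integral_cong_AE)
      show "(\<lambda>x. (indicator {a<..<b} x * v x) * g x) \<in> borel_measurable lebesgue"
        using borel_measurable_integrable[OF int] g by (rule borel_measurable_times)
      show "(\<lambda>x. v' x * g x) \<in> borel_measurable lebesgue"
        using v'_meas g by (rule borel_measurable_times)
      show "AE x in lebesgue. (indicator {a<..<b} x * v x) * g x = v' x * g x"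
        unfolding AE_completion_iff using ae by eventually_elim simp
    qed
    also have "\<dots> = (\<integral>x. v' x * g x \<partial>lborel)" by (rule integral_completion) simp
    finally show ?thesis .
  qed
  ultimately show thesis using that by blast
qed

lemma test_function_continuous:
  assumes "test_function a b \<psi>"
  shows "continuous_on UNIV \<psi>" "continuous_on UNIV (deriv \<psi>)"
    and "(\<psi> has_real_derivative deriv \<psi> x) (at x)"
    and "x \<notin> {a<..<b} \<Longrightarrow> \<psi> x = 0"
proof -
  from assms have d: "((deriv ^^ n) \<psi>) differentiable_on UNIV" for n
    by (simp add: test_function_def)
  show "continuous_on UNIV \<psi>" using d[of 0] by (simp add: differentiable_imp_continuous_on)
  show "continuous_on UNIV (deriv \<psi>)" using d[of 1] by (simp add: differentiable_imp_continuous_on)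
  show "(\<psi> has_real_derivative deriv \<psi> x) (at x)"
    using d[of 0] by (simp add: differentiable_on_def DERIV_deriv_iff_real_differentiable)
  show "\<psi> x = 0" if "x \<notin> {a<..<b}"
    using assms that closure_subset[of "{x. \<psi> x \<noteq> 0}"] by (auto simp: test_function_def)
qed

lemma test_function_measurable:
  assumes "test_function a b \<psi>"
  shows "\<psi> \<in> borel_measurable borel" "deriv \<psi> \<in> borel_measurable borel"
  using test_function_continuous(1,2)[OF assms] by (auto intro: borel_measurable_continuous_onI)

lemma absolutely_integrable_mult_continuous:
  fixes v g :: "real \<Rightarrow> real"
  assumes "v absolutely_integrable_on {a<..<b}" "continuous_on UNIV g"
  shows "(\<lambda>x. v x * g x) absolutely_integrable_on {a<..<b}"
proof -
  have "bounded (g ` {a..b})"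
    using assms by (intro compact_imp_bounded compact_continuous_image) (auto intro: continuous_on_subset)
  then have "bounded (g ` {a<..<b})" by (rule bounded_subset) auto
  moreover have "g \<in> borel_measurable (lebesgue_on {a<..<b})"
    using assms by (intro continuous_imp_measurable_on_sets_lebesgue) (auto intro: continuous_on_subset)
  ultimately have "(\<lambda>x. g x * v x) absolutely_integrable_on {a<..<b}"
    using assms by (intro absolutely_integrable_bounded_measurable_product_real) auto
  then show ?thesis by (simp add: mult.commute)
qed

lemma has_weak_derivative_diff:
  assumes "has_weak_derivative u1 v1 a b" "has_weak_derivative u2 v2 a b"
  shows "has_weak_derivative (\<lambda>x. u1 x - u2 x) (\<lambda>x. v1 x - v2 x) a b"
proof -
  have ai: "u1 absolutely_integrable_on {a<..<b}" "u2 absolutely_integrable_on {a<..<b}"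
    "v1 absolutely_integrable_on {a<..<b}" "v2 absolutely_integrable_on {a<..<b}"
    using assms by (auto simp: has_weak_derivative_def)
  have "(LINT x:{a<..<b}|lebesgue. (u1 x - u2 x) * deriv \<psi> x) = - (LINT x:{a<..<b}|lebesgue. (v1 x - v2 x) * \<psi> x)"
    if \<psi>: "test_function a b \<psi>" for \<psi>
  proof -
    note cont = test_function_continuous(1,2)[OF \<psi>]
    from assms \<psi> have "(LINT x:{a<..<b}|lebesgue. u1 x * deriv \<psi> x) = - (LINT x:{a<..<b}|lebesgue. v1 x * \<psi> x)"
      "(LINT x:{a<..<b}|lebesgue. u2 x * deriv \<psi> x) = - (LINT x:{a<..<b}|lebesgue. v2 x * \<psi> x)"
      by (auto simp: has_weak_derivative_def)
    then show ?thesis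
      using ai cont by (simp add: left_diff_distrib set_integral_diff absolutely_integrable_mult_continuous)
  qed
  then show ?thesis
    using ai by (auto simp: has_weak_derivative_def intro: set_integral_diff)
qed

text \<open>Integration by parts done by Fubini over the triangle a < s < x < b: the inner integral
  of \<psi>' from s to b equals -\<psi>(s), because \<psi> vanishes at b.\<close>

lemma has_weak_derivative_indefinite_integral:
  assumes \<phi>: "integrable lborel \<phi>" and "a < b"
  shows "has_weak_derivative (\<lambda>x. \<integral>s. indicator {a<..<x} s * \<phi> s \<partial>lborel) \<phi> a b"
proof -
  have [measurable]: "\<phi> \<in> borel_measurable borel" using \<phi> by auto
  define \<Phi> where "\<Phi> x = (\<integral>s. indicator {a<..<x} s * \<phi> s \<partial>lborel)" for x
  have \<Phi>_alt: "\<Phi> = (\<lambda>x. \<integral>s. (if a < s \<and> s < x then \<phi> s else 0) \<partial>lborel)"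
    unfolding \<Phi>_def by (auto intro!: Bochner_Integration.integral_cong simp: indicator_def)
  have \<Phi>_meas [measurable]: "\<Phi> \<in> borel_measurable borel"
    unfolding \<Phi>_alt by measurable
  have \<Phi>_bound: "\<bar>\<Phi> x\<bar> \<le> (\<integral>s. \<bar>\<phi> s\<bar> \<partial>lborel)" for x
  proof -
    have "\<bar>\<Phi> x\<bar> \<le> (\<integral>s. \<bar>indicator {a<..<x} s * \<phi> s\<bar> \<partial>lborel)"
      unfolding \<Phi>_def by (rule integral_abs_bound)
    also have "\<dots> \<le> (\<integral>s. \<bar>\<phi> s\<bar> \<partial>lborel)"
      using \<phi> integrable_mult_indicator[OF _ \<phi>, of "{a<..<x}"]
      by (intro integral_mono) (auto simp: indicator_def)
    finally show ?thesis .
  qed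
  have int_lborel: "integrable lborel (\<lambda>x. indicator {a<..<b} x * \<Phi> x)"
  proof (rule Bochner_Integration.integrable_bound)
    show "integrable lborel (\<lambda>x. indicator {a<..<b} x * (\<integral>s. \<bar>\<phi> s\<bar> \<partial>lborel))"
      using \<open>a < b\<close> by (intro integrable_mult_left) auto
    show "AE x in lborel. norm (indicator {a<..<b} x * \<Phi> x) \<le> norm (indicator {a<..<b} x * (\<integral>s. \<bar>\<phi> s\<bar> \<partial>lborel))"
      using \<Phi>_bound by (auto simp: indicator_def)
  qed measurable
  have ai_\<Phi>: "\<Phi> absolutely_integrable_on {a<..<b}"
    using int_lborel by (simp add: set_integrable_def integrable_completion)
  have ai_\<phi>: "\<phi> absolutely_integrable_on {a<..<b}"
    using integrable_mult_indicator[OF _ \<phi>, of "{a<..<b}"] by (simp add: set_integrable_def integrable_completion)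
  have "(LINT x:{a<..<b}|lebesgue. \<Phi> x * deriv \<psi> x) = - (LINT x:{a<..<b}|lebesgue. \<phi> x * \<psi> x)"
    if \<psi>: "test_function a b \<psi>" for \<psi>
  proof -
    note cont = test_function_continuous[OF \<psi>]
    note [measurable] = test_function_measurable[OF \<psi>]
    define \<delta> where "\<delta> x = indicator {a<..<b} x * deriv \<psi> x" for x
    have [measurable]: "\<delta> \<in> borel_measurable borel" unfolding \<delta>_def by measurable
    have \<delta>_int: "integrable lborel \<delta>"
    proof -
      have "integrable lborel (\<lambda>x. indicator {a<..<b} x * (indicator {a..b} x *\<^sub>R deriv \<psi> x))"
        using cont(2) by (intro integrable_mult_indicator[where 'b=real, simplified] borel_integrable_compact)
          (auto intro: continuous_on_subset)
      moreover have "indicator {a<..<b} x * (indicator {a..b} x *\<^sub>R deriv \<psi> x) = \<delta> x" for x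
        by (auto simp: \<delta>_def indicator_def)
      ultimately show ?thesis by simp
    qed
    define F where "F x s = (if a < s \<and> s < x then 1 else 0) * \<delta> x * \<phi> s" for x s
    have F_meas: "case_prod F \<in> borel_measurable (borel \<Otimes>\<^sub>M borel)" unfolding F_def by measurable
    have F_ind: "F x s = indicator {s<..} x * \<delta> x * (indicator {a<..} s * \<phi> s)" for x s
      by (auto simp: F_def indicator_def)
    have ind_int: "integrable lborel (\<lambda>x. indicator {s<..} x * \<delta> x)" for s
      using integrable_mult_indicator[OF _ \<delta>_int, of "{s<..}"] by simp
    have inner: "integrable lborel (\<lambda>x. F x s)" for s
      unfolding F_ind using ind_int by simp
    have outer: "integrable lborel (\<lambda>s. \<integral>x. \<bar>F x s\<bar> \<partial>lborel)"
    proof (rule Bochner_Integration.integrable_bound)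
      show "integrable lborel (\<lambda>s. (\<integral>x. \<bar>\<delta> x\<bar> \<partial>lborel) * \<bar>\<phi> s\<bar>)" using \<phi> by simp
      show "(\<lambda>s. \<integral>x. \<bar>F x s\<bar> \<partial>lborel) \<in> borel_measurable lborel"
        unfolding F_def by measurable
      have "(\<integral>x. \<bar>F x s\<bar> \<partial>lborel) \<le> (\<integral>x. \<bar>\<delta> x\<bar> * \<bar>\<phi> s\<bar> \<partial>lborel)" for s
        using integrable_abs[OF inner[of s]] \<delta>_int by (intro integral_mono) (auto simp: F_def abs_mult)
      then show "AE s in lborel. norm (\<integral>x. \<bar>F x s\<bar> \<partial>lborel) \<le> norm ((\<integral>x. \<bar>\<delta> x\<bar> \<partial>lborel) * \<bar>\<phi> s\<bar>)"
        by (auto simp: abs_mult)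
    qed
    note swap = Fubini_swap[OF F_meas AE_I2[OF inner] outer]
    have tail: "(\<integral>x. indicator {s<..} x * \<delta> x \<partial>lborel) = - \<psi> s" if "s \<in> {a<..<b}" for s
    proof -
      have "(\<integral>x. indicator {s<..} x * \<delta> x \<partial>lborel) = (\<integral>x. indicator {s..b} x *\<^sub>R deriv \<psi> x \<partial>lborel)"
      proof (rule integral_cong_AE)
        show "AE x in lborel. indicator {s<..} x * \<delta> x = indicator {s..b} x *\<^sub>R deriv \<psi> x"
          using AE_lborel_singleton[of s] AE_lborel_singleton[of b]
          by eventually_elim (use that in \<open>auto simp: \<delta>_def indicator_def\<close>)
      qed measurable
      also have "\<dots> = \<psi> b - \<psi> s"
        using that cont by (intro integral_FTC_atLeastAtMost)
          (auto simp: has_real_derivative_iff_has_vector_derivative[symmetric]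
            intro: has_field_derivative_at_within continuous_on_subset)
      also have "\<psi> b = 0" by (rule cont(4)) simp
      finally show ?thesis by simp
    qed
    have "(LINT x:{a<..<b}|lebesgue. \<Phi> x * deriv \<psi> x) = (\<integral>x. \<delta> x * \<Phi> x \<partial>lebesgue)"
      unfolding set_lebesgue_integral_def \<delta>_def by (simp add: mult_ac)
    also have "\<dots> = (\<integral>x. \<delta> x * \<Phi> x \<partial>lborel)"
      by (rule integral_completion) simp
    also have "\<dots> = (\<integral>x. \<integral>s. F x s \<partial>lborel \<partial>lborel)"
    proof (rule Bochner_Integration.integral_cong[OF refl])
      fix x
      have "F x s = \<delta> x * (indicator {a<..<x} s * \<phi> s)" for s by (auto simp: F_def indicator_def)
      then show "\<delta> x * \<Phi> x = (\<integral>s. F x s \<partial>lborel)" by (simp add: \<Phi>_def)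
    qed
    also have "\<dots> = (\<integral>s. \<integral>x. F x s \<partial>lborel \<partial>lborel)" by (rule swap(3))
    also have "\<dots> = (\<integral>s. - (indicator {a<..<b} s * (\<phi> s * \<psi> s)) \<partial>lborel)"
    proof (rule Bochner_Integration.integral_cong[OF refl])
      fix s
      have zero: "indicator {s<..} x * \<delta> x = 0" if "b \<le> s" for x
        using that by (auto simp: \<delta>_def indicator_def)
      have "(\<integral>x. indicator {s<..} x * \<delta> x \<partial>lborel) = 0" if "b \<le> s"
        unfolding zero[OF that] by simp
      then show "(\<integral>x. F x s \<partial>lborel) = - (indicator {a<..<b} s * (\<phi> s * \<psi> s))"
        unfolding F_ind using tail[of s] by (cases "s < b"; cases "a < s") auto
    qed
    also have "\<dots> = - (\<integral>s. indicator {a<..<b} s * (\<phi> s * \<psi> s) \<partial>lborel)" by simp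
    also have "(\<integral>s. indicator {a<..<b} s * (\<phi> s * \<psi> s) \<partial>lborel) = (LINT x:{a<..<b}|lebesgue. \<phi> x * \<psi> x)"
      unfolding set_lebesgue_integral_def by (simp add: integral_completion)
    finally show ?thesis .
  qed
  then show ?thesis
    using ai_\<Phi> ai_\<phi> unfolding has_weak_derivative_def \<Phi>_def by blast
qed

text \<open>Du Bois-Reymond lemma.  The differences of two translated bumps are derivatives of test functions,
  so in the limit all averages of \<open>w\<close> over short intervals of equal length coincide.\<close>

lemma weak_derivative_zero_imp_AE_const:
  assumes w: "integrable lborel w" and "a < b"
    and ortho: "\<And>\<psi>. test_function a b \<psi> \<Longrightarrow> (\<integral>x. w x * deriv \<psi> x \<partial>lborel) = 0"
  obtains c where "AE x in lborel. x \<in> {a<..<b} \<longrightarrow> w x = c"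
proof -
  have [measurable]: "w \<in> borel_measurable borel" using w by auto
  have avg: "(\<integral>u. indicator {0<..<h} u * w (p - u) \<partial>lborel) = (\<integral>u. indicator {0<..<h} u * w (r - u) \<partial>lborel)"
    if h: "a < p - h" "p < b" "a < r - h" "r < b" "0 < h" for p r h
  proof -
    have lim: "(\<lambda>n. \<integral>x. w x * bump n l u x \<partial>lborel) \<longlonglongrightarrow> (\<integral>x. w x * indicator {l<..<u} x \<partial>lborel)" for l u
    proof (rule integral_dominated_convergence)
      show "integrable lborel (\<lambda>x. \<bar>w x\<bar>)" using w by simp
      show "AE x in lborel. (\<lambda>n. w x * bump n l u x) \<longlonglongrightarrow> w x * indicator {l<..<u} x"
        by (intro AE_I2 tendsto_intros bump_tendsto)
      show "AE x in lborel. norm (w x * bump n l u x) \<le> \<bar>w x\<bar>" for n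
        by (intro AE_I2) (simp add: abs_mult mult_left_le abs_bump_le_1)
    qed measurable
    have bump_int: "integrable lborel (\<lambda>x. w x * bump n l u x)" for n l u
    proof (rule Bochner_Integration.integrable_bound[OF w])
      show "AE x in lborel. norm (w x * bump n l u x) \<le> norm (w x)"
        by (intro AE_I2) (simp add: abs_mult mult_left_le abs_bump_le_1)
    qed measurable
    have "(\<integral>x. w x * bump n (p - h) p x \<partial>lborel) = (\<integral>x. w x * bump n (r - h) r x \<partial>lborel)" for n
    proof -
      obtain \<psi> where \<psi>: "test_function a b \<psi>" "\<And>x. deriv \<psi> x = bump n (p - h) p x - bump n (r - h) r x"
        using test_function_bump_diff[OF h] by metis
      from ortho[OF \<psi>(1)] show ?thesis
        unfolding \<psi>(2) right_diff_distrib using bump_int by simp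
    qed
    then have eq: "(\<integral>x. w x * indicator {p-h<..<p} x \<partial>lborel) = (\<integral>x. w x * indicator {r-h<..<r} x \<partial>lborel)"
      using lim[of "p - h" p] lim[of "r - h" r] by (auto intro: LIMSEQ_unique)
    have shift: "(\<integral>x. w x * indicator {q-h<..<q} x \<partial>lborel) = (\<integral>u. indicator {0<..<h} u * w (q - u) \<partial>lborel)" for q
      by (subst lborel_integral_real_affine[where c="-1" and t=q])
        (auto intro!: Bochner_Integration.integral_cong simp: indicator_def)
    show ?thesis using eq by (simp add: shift)
  qed
  define D where "D \<tau> \<longleftrightarrow> ((\<lambda>h. (\<integral>u. indicator {0<..<h} u * w (\<tau> - u) \<partial>lborel) / h) \<longlongrightarrow> w \<tau>) (at_right 0)" for \<tau>
  have AE_D: "AE \<tau> in lborel. D \<tau>" unfolding D_def by (rule AE_left_density[OF w])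
  have const: "w p = w r" if "p \<in> {a<..<b}" "r \<in> {a<..<b}" "D p" "D r" for p r
  proof (rule tendsto_unique[OF trivial_limit_at_right_real])
    show "((\<lambda>h. (\<integral>u. indicator {0<..<h} u * w (p - u) \<partial>lborel) / h) \<longlongrightarrow> w p) (at_right 0)"
      using that by (simp add: D_def)
    have "eventually (\<lambda>h. (\<integral>u. indicator {0<..<h} u * w (r - u) \<partial>lborel) / h = (\<integral>u. indicator {0<..<h} u * w (p - u) \<partial>lborel) / h) (at_right 0)"
      unfolding eventually_at_right_field
    \<comment> \<open>The averages agree only while both windows of length h remain inside the
      interval, hence the distances to \<open>a\<close>.\<close>
    proof (intro exI[of _ "min (p - a) (r - a)"] conjI allI impI)
      fix h assume "0 < h" "h < min (p - a) (r - a)"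
      then show "(\<integral>u. indicator {0<..<h} u * w (r - u) \<partial>lborel) / h = (\<integral>u. indicator {0<..<h} u * w (p - u) \<partial>lborel) / h"
        using that avg[of r h p] by auto
    qed (use that in auto)
    then show "((\<lambda>h. (\<integral>u. indicator {0<..<h} u * w (p - u) \<partial>lborel) / h) \<longlongrightarrow> w r) (at_right 0)"
      using that(4) unfolding D_def by (rule Lim_transform_eventually[rotated])
  qed
  show thesis
  proof (cases "\<exists>r\<in>{a<..<b}. D r")
    case True
    then obtain r where r: "r \<in> {a<..<b}" "D r" by blast
    have "AE x in lborel. x \<in> {a<..<b} \<longrightarrow> w x = w r"
      using AE_D by eventually_elim (use const r in blast)
    then show thesis by (rule that)
  next
    case False
    have "AE x in lborel. x \<in> {a<..<b} \<longrightarrow> w x = 0"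
      using AE_D by eventually_elim (use False in blast)
    then show thesis by (rule that)
  qed
qed

text \<open>Subtracting from \<open>u\<close> the primitive of a representative of \<open>v\<close>
  leaves a function with almost everywhere zero weak derivative, to which the Du Bois-Reymond lemma
  applies.\<close>

lemma weak_derivative_imp_indefinite_integral:
  assumes uv: "has_weak_derivative u v a b" and "a < b"
  obtains v' c where "integrable lborel v'" "\<And>x. x \<notin> {a<..<b} \<Longrightarrow> v' x = 0"
    "AE x in lborel. x \<in> {a<..<b} \<longrightarrow> v x = v' x"
    "AE x in lborel. x \<in> {a<..<b} \<longrightarrow> u x = c + (\<integral>s. indicator {a<..<x} s * v' s \<partial>lborel)"
proof -
  have ai: "u absolutely_integrable_on {a<..<b}" "v absolutely_integrable_on {a<..<b}"
    using uv by (auto simp: has_weak_derivative_def)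
  from absolutely_integrable_borel_representative[OF ai(2)] obtain v' where v':
    "integrable lborel v'" "\<And>x. x \<notin> {a<..<b} \<Longrightarrow> v' x = 0"
    "AE x in lborel. x \<in> {a<..<b} \<longrightarrow> v x = v' x"
    "\<And>g. g \<in> borel_measurable borel \<Longrightarrow> (LINT x:{a<..<b}|lebesgue. v x * g x) = (\<integral>x. v' x * g x \<partial>lborel)"
    by blast
  define \<Phi> where "\<Phi> x = (\<integral>s. indicator {a<..<x} s * v' s \<partial>lborel)" for x
  have wd: "has_weak_derivative (\<lambda>x. u x - \<Phi> x) (\<lambda>x. v x - v' x) a b"
    unfolding \<Phi>_def by (intro has_weak_derivative_diff uv has_weak_derivative_indefinite_integral v' assms)
  then have "(\<lambda>x. u x - \<Phi> x) absolutely_integrable_on {a<..<b}" "(\<lambda>x. v x - v' x) absolutely_integrable_on {a<..<b}"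
    by (auto simp: has_weak_derivative_def)
  note diff_ai = this
  obtain w where w: "integrable lborel w"
    "AE x in lborel. x \<in> {a<..<b} \<longrightarrow> u x - \<Phi> x = w x"
    "\<And>g. g \<in> borel_measurable borel \<Longrightarrow> (LINT x:{a<..<b}|lebesgue. (u x - \<Phi> x) * g x) = (\<integral>x. w x * g x \<partial>lborel)"
    by (rule absolutely_integrable_borel_representative[OF diff_ai(1)]) (rule that)
  obtain z where z: "integrable lborel z" "\<And>x. x \<notin> {a<..<b} \<Longrightarrow> z x = 0"
    "AE x in lborel. x \<in> {a<..<b} \<longrightarrow> v x - v' x = z x"
    "\<And>g. g \<in> borel_measurable borel \<Longrightarrow> (LINT x:{a<..<b}|lebesgue. (v x - v' x) * g x) = (\<integral>x. z x * g x \<partial>lborel)"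
    by (rule absolutely_integrable_borel_representative[OF diff_ai(2)]) (rule that)
  have z0: "AE x in lborel. z x = 0"
    using z(3) v'(3) by eventually_elim (use z(2) in force)
  have "(\<integral>x. w x * deriv \<psi> x \<partial>lborel) = 0" if \<psi>: "test_function a b \<psi>" for \<psi>
  proof -
    have "(\<integral>x. w x * deriv \<psi> x \<partial>lborel) = - (\<integral>x. z x * \<psi> x \<partial>lborel)"
      using wd \<psi> test_function_measurable[OF \<psi>] w(3)[of "deriv \<psi>"] z(4)[of \<psi>] by (simp add: has_weak_derivative_def)
    also have "(\<integral>x. z x * \<psi> x \<partial>lborel) = 0"
      using z0 by (intro integral_eq_zero_AE) (auto elim: eventually_mono)
    finally show ?thesis by simp
  qed
  from weak_derivative_zero_imp_AE_const[OF w(1) assms(2) this] obtain c where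
    c: "AE x in lborel. x \<in> {a<..<b} \<longrightarrow> w x = c" by blast
  have "AE x in lborel. x \<in> {a<..<b} \<longrightarrow> u x = c + \<Phi> x"
    using c w(2) by eventually_elim auto
  then show thesis using that[OF v'(1,2,3), of c] by (simp add: \<Phi>_def)
qed

section \<open>Abel inversion\<close>

lemma AE_imp_ex_in_interval:
  fixes l u :: real
  assumes "AE x in lborel. P x" "l < u"
  obtains x where "x \<in> {l<..<u}" "P x"
proof (rule ccontr)
  assume "\<not> thesis"
  with that have "AE x in lborel. x \<notin> {l<..<u}" by (auto intro: eventually_mono[OF assms(1)])
  then have "{l<..<u} \<in> null_sets lborel" by (subst (asm) AE_iff_null_sets[symmetric]) auto
  with \<open>l < u\<close> show False by (simp add: null_sets_def)
qed

lemma convolve_eq_lborel: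
  assumes [measurable]: "k \<in> borel_measurable borel" "g \<in> borel_measurable borel"
  shows "convolve k g t = (\<integral>s. k (t - s) * g s \<partial>lborel)"
  unfolding convolve_def by (rule integral_completion) measurable

text \<open>Off the point \<open>a\<close>, such a \<open>g\<close> is dominated by \<open>M\<close>
  times the order-one kernel started at \<open>a\<close>, and the semigroup law integrates that
  majorant. The resulting power of t - a later forces the integration constant in the inversion to
  vanish.\<close>

lemma frac_kernel_bounded_integrable:
  assumes "0 < \<beta>" and [measurable]: "g \<in> borel_measurable borel"
    and bound: "\<And>s. \<bar>g s\<bar> \<le> M" and supp: "\<And>s. s < a \<Longrightarrow> g s = 0"
  shows "integrable lborel (\<lambda>s. frac_kernel \<beta> (t - s) * g s)"
    and "\<bar>\<integral>s. frac_kernel \<beta> (t - s) * g s \<partial>lborel\<bar> \<le> M * frac_kernel (\<beta> + 1) (t - a)"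
proof -
  have le: "AE s in lborel. \<bar>frac_kernel \<beta> (t - s) * g s\<bar> \<le> M * (frac_kernel \<beta> (t - s) * frac_kernel 1 (s - a))"
    using AE_lborel_singleton[of a]
  proof eventually_elim
    case (elim s)
    have "\<bar>g s\<bar> \<le> M * frac_kernel 1 (s - a)"
      using elim bound[of s] supp[of s] by (cases "s < a") (auto simp: frac_kernel_1)
    from mult_left_mono[OF this frac_kernel_nonneg[OF \<open>0 < \<beta>\<close>, of "t - s"]]
    show ?case using \<open>0 < \<beta>\<close> by (simp add: abs_mult frac_kernel_nonneg mult_ac)
  qed
  note sg = frac_kernel_semigroup[OF \<open>0 < \<beta>\<close> zero_less_one, of t a]
  have int_dom: "integrable lborel (\<lambda>s. M * (frac_kernel \<beta> (t - s) * frac_kernel 1 (s - a)))"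
    using sg(1) by simp
  show int: "integrable lborel (\<lambda>s. frac_kernel \<beta> (t - s) * g s)"
  proof (rule Bochner_Integration.integrable_bound[OF int_dom])
    show "AE s in lborel. norm (frac_kernel \<beta> (t - s) * g s) \<le> norm (M * (frac_kernel \<beta> (t - s) * frac_kernel 1 (s - a)))"
      using le by eventually_elim simp
  qed measurable
  have "\<bar>\<integral>s. frac_kernel \<beta> (t - s) * g s \<partial>lborel\<bar> \<le> (\<integral>s. \<bar>frac_kernel \<beta> (t - s) * g s\<bar> \<partial>lborel)"
    by (rule integral_abs_bound)
  also have "\<dots> \<le> (\<integral>s. M * (frac_kernel \<beta> (t - s) * frac_kernel 1 (s - a)) \<partial>lborel)"
    using le int int_dom by (intro integral_mono_AE) auto
  also have "\<dots> = M * frac_kernel (\<beta> + 1) (t - a)" using sg(2) by simp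
  finally show "\<bar>\<integral>s. frac_kernel \<beta> (t - s) * g s \<partial>lborel\<bar> \<le> M * frac_kernel (\<beta> + 1) (t - a)" .
qed

lemma zero_extension_facts:
  assumes g: "continuous_on {a..b} g"
  obtains M where "zero_extension a b g \<in> borel_measurable borel"
    "integrable lborel (zero_extension a b g)" "\<And>s. \<bar>zero_extension a b g s\<bar> \<le> M"
    "\<And>s. s < a \<Longrightarrow> zero_extension a b g s = 0"
proof -
  have int: "integrable lborel (\<lambda>x. indicator {a..b} x *\<^sub>R g x)"
    by (rule borel_integrable_compact) (use g in auto)
  have eq: "zero_extension a b g = (\<lambda>x. indicator {a..b} x *\<^sub>R g x)"
    by (auto simp: zero_extension_def fun_eq_iff)
  have "bounded (g ` {a..b})"
    using g by (intro compact_imp_bounded compact_continuous_image) auto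
  then obtain M where "\<forall>y\<in>g ` {a..b}. norm y \<le> M" unfolding bounded_iff by blast
  then have M: "\<bar>g x\<bar> \<le> M" if "x \<in> {a..b}" for x using that by simp
  have "\<bar>zero_extension a b g s\<bar> \<le> \<bar>M\<bar>" for s
    using M[of s] by (auto simp: zero_extension_def)
  moreover have "zero_extension a b g s = 0" if "s < a" for s
    using that by (simp add: zero_extension_def)
  ultimately show thesis using that int unfolding eq by auto
qed

text \<open>Differences of the vanishing primitive at \<open>\<tau>\<close> and \<tau> - h are the
  left averages of \<open>d\<close>, so all left densities below \<open>b\<close> are zero.\<close>

lemma integral_zero_all_imp_AE_zero:
  fixes d :: "real \<Rightarrow> real"
  assumes d: "integrable lborel d"
    and zero: "\<And>t. t \<le> b \<Longrightarrow> (\<integral>s. frac_kernel 1 (t - s) * d s \<partial>lborel) = 0"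
  shows "AE \<tau> in lborel. \<tau> < b \<longrightarrow> d \<tau> = 0"
  using AE_left_density[OF d]
proof eventually_elim
  case (elim \<tau>)
  have [measurable]: "d \<in> borel_measurable borel" using d by auto
  have avg: "(\<integral>u. indicator {0<..<h} u * d (\<tau> - u) \<partial>lborel) / h = 0" if "0 < h" "\<tau> < b" for h
  proof -
    have int: "integrable lborel (\<lambda>s. frac_kernel 1 (t - s) * d s)" for t
    proof -
      have eq: "frac_kernel 1 (t - s) * d s = indicator {..<t} s *\<^sub>R d s" for s
        by (auto simp: frac_kernel_1 indicator_def)
      show ?thesis unfolding eq by (intro integrable_mult_indicator d) simp
    qed
    have "(\<integral>u. indicator {0<..<h} u * d (\<tau> - u) \<partial>lborel) = (\<integral>s. indicator {\<tau>-h<..<\<tau>} s * d s \<partial>lborel)"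
      by (subst (2) lborel_integral_real_affine[where c="-1" and t=\<tau>])
        (auto intro!: Bochner_Integration.integral_cong simp: indicator_def)
    also have "\<dots> = (\<integral>s. frac_kernel 1 (\<tau> - s) * d s - frac_kernel 1 (\<tau> - h - s) * d s \<partial>lborel)"
    proof (rule integral_cong_AE)
      show "AE s in lborel. indicator {\<tau>-h<..<\<tau>} s * d s = frac_kernel 1 (\<tau> - s) * d s - frac_kernel 1 (\<tau> - h - s) * d s"
        using AE_lborel_singleton[of "\<tau> - h"]
        by eventually_elim (use that in \<open>auto simp: frac_kernel_1 indicator_def\<close>)
    qed measurable
    also have "\<dots> = 0" using int zero that by simp
    finally show ?thesis by simp
  qed
  show ?case
  proof
    assume "\<tau> < b"
    have "((\<lambda>h. (\<integral>u. indicator {0<..<h} u * d (\<tau> - u) \<partial>lborel) / h) \<longlongrightarrow> 0) (at_right 0)"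
      by (rule tendsto_eventually) (use avg \<open>\<tau> < b\<close> in \<open>auto simp: eventually_at_right_field intro!: exI[of _ 1]\<close>)
    from tendsto_unique[OF trivial_limit_at_right_real elim this] show "d \<tau> = 0" .
  qed
qed

text \<open>Abel's method. The convolution of order 1 - \<alpha> of \<open>g\<close> is a constant
  plus the primitive of \<open>V\<close>, and the constant is zero. Convolving once more with order
  \<alpha> gives equal primitives of \<open>g\<close> and of the order-\<alpha> integral of
  \<open>V\<close>; differentiating them yields the claim almost everywhere.\<close>

lemma frac_conv_weak_derivative_inversion:
  assumes \<alpha>: "0 < \<alpha>" "\<alpha> < 1" and "a < b" and g: "continuous_on {a..b} g"
    and wd: "has_weak_derivative (frac_conv (1 - \<alpha>) a b g) v a b"
  obtains V where "integrable lborel V" "\<And>x. x \<notin> {a<..<b} \<Longrightarrow> V x = 0"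
    "AE x in lborel. x \<in> {a<..<b} \<longrightarrow> v x = V x"
    "AE x in lborel. x \<in> {a<..<b} \<longrightarrow> g x = (\<integral>s. frac_kernel \<alpha> (x - s) * V s \<partial>lborel)"
proof -
  obtain M where Z: "zero_extension a b g \<in> borel_measurable borel"
    "integrable lborel (zero_extension a b g)" "\<And>s. \<bar>zero_extension a b g s\<bar> \<le> M"
    "\<And>s. s < a \<Longrightarrow> zero_extension a b g s = 0"
    by (rule zero_extension_facts[OF g]) (rule that)
  define Z where "Z = zero_extension a b g"
  note Z = Z[folded Z_def]
  note [measurable] = Z(1)
  define G where "G = frac_conv (1 - \<alpha>) a b g"
  have G_eq: "G t = (\<integral>s. frac_kernel (1 - \<alpha>) (t - s) * Z s \<partial>lborel)" for t
    unfolding G_def frac_conv_def Z_def[symmetric] by (rule convolve_eq_lborel) measurable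
  have G_bound: "\<bar>G t\<bar> \<le> M * frac_kernel (2 - \<alpha>) (t - a)" for t
    using frac_kernel_bounded_integrable(2)[of "1 - \<alpha>" Z M a t] Z \<alpha> by (simp add: G_eq)
  have G0: "G t = 0" if "t \<le> a" for t
  proof -
    have zero: "frac_kernel (1 - \<alpha>) (t - s) * Z s = 0" for s
      using that Z(4)[of s] by (cases "s < a") (auto simp: frac_kernel_def)
    show ?thesis unfolding G_eq zero by simp
  qed
  obtain V c where V: "integrable lborel V" "\<And>x. x \<notin> {a<..<b} \<Longrightarrow> V x = 0"
    "AE x in lborel. x \<in> {a<..<b} \<longrightarrow> v x = V x"
    and G_V: "AE x in lborel. x \<in> {a<..<b} \<longrightarrow> G x = c + (\<integral>s. indicator {a<..<x} s * V s \<partial>lborel)"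
    by (rule weak_derivative_imp_indefinite_integral[OF wd \<open>a < b\<close>, folded G_def]) (rule that)
  have [measurable]: "V \<in> borel_measurable borel" using V by auto
  \<comment> \<open>Continuity of \<open>g\<close> on the closed interval makes it bounded, so G(t)
    = O((t - a)^(1-\<alpha>)). The primitive of \<open>V\<close> also tends to 0 at
    \<open>a\<close>. The representation holds only almost everywhere, but such points exist
    arbitrarily close to \<open>a\<close>.\<close>
  have "c = 0"
  proof -
    define \<delta> where "\<delta> n = (b - a) / real (Suc n)" for n
    have \<delta>: "0 < \<delta> n" "\<delta> n \<le> b - a" for n
    proof -
      show "0 < \<delta> n" using \<open>a < b\<close> by (simp add: \<delta>_def)
      have "(b - a) / real (Suc n) \<le> (b - a) / 1" using \<open>a < b\<close> by (intro divide_left_mono) auto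
      then show "\<delta> n \<le> b - a" by (simp add: \<delta>_def)
    qed
    have \<delta>_lim: "\<delta> \<longlonglongrightarrow> 0"
      unfolding \<delta>_def using LIMSEQ_Suc[OF lim_const_over_n[of "b - a"]] by simp
    define e where "e n = M * (\<delta> n powr (1 - \<alpha>) / Gamma (2 - \<alpha>)) + (\<integral>s. indicator {a<..<a + \<delta> n} s * \<bar>V s\<bar> \<partial>lborel)" for n
    have M: "0 \<le> M" using Z(3)[of 0] by simp
    have "\<bar>c\<bar> \<le> e n" for n
    proof -
      obtain x where x: "x \<in> {a<..<a + \<delta> n}"
        "x \<in> {a<..<b} \<longrightarrow> G x = c + (\<integral>s. indicator {a<..<x} s * V s \<partial>lborel)"
        using AE_imp_ex_in_interval[OF G_V, of a "a + \<delta> n"] \<delta>[of n] by auto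
      have x_in: "x \<in> {a<..<b}" using x(1) \<delta>(2)[of n] by auto
      have "frac_kernel (2 - \<alpha>) (x - a) \<le> \<delta> n powr (1 - \<alpha>) / Gamma (2 - \<alpha>)"
        using x(1) \<alpha> unfolding frac_kernel_def
        by (auto intro!: divide_right_mono powr_mono2 simp: Gamma_real_pos less_imp_le)
      then have 1: "\<bar>G x\<bar> \<le> M * (\<delta> n powr (1 - \<alpha>) / Gamma (2 - \<alpha>))"
        using G_bound[of x] M by (meson mult_left_mono order_trans)
      have "\<bar>\<integral>s. indicator {a<..<x} s * V s \<partial>lborel\<bar> \<le> (\<integral>s. \<bar>indicator {a<..<x} s * V s\<bar> \<partial>lborel)"
        by (rule integral_abs_bound)
      also have "\<dots> \<le> (\<integral>s. indicator {a<..<a + \<delta> n} s * \<bar>V s\<bar> \<partial>lborel)"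
      proof (rule integral_mono)
        show "integrable lborel (\<lambda>s. \<bar>indicator {a<..<x} s * V s\<bar>)"
          using integrable_mult_indicator[OF _ V(1), of "{a<..<x}"] by (intro integrable_abs) simp
        show "integrable lborel (\<lambda>s. indicator {a<..<a + \<delta> n} s * \<bar>V s\<bar>)"
          using integrable_mult_indicator[OF _ integrable_abs[OF V(1)], of "{a<..<a + \<delta> n}"] by simp
        show "\<bar>indicator {a<..<x} s * V s\<bar> \<le> indicator {a<..<a + \<delta> n} s * \<bar>V s\<bar>" for s
          using x(1) by (auto simp: indicator_def)
      qed
      finally show ?thesis using 1 x(2) x_in unfolding e_def by auto
    qed
    moreover have "e \<longlonglongrightarrow> M * (0 powr (1 - \<alpha>) / Gamma (2 - \<alpha>)) + (\<integral>s. 0 \<partial>(lborel :: real measure))"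
      unfolding e_def
    proof (intro tendsto_intros \<delta>_lim)
      show "(\<lambda>n. \<integral>s. indicator {a<..<a + \<delta> n} s * \<bar>V s\<bar> \<partial>lborel) \<longlonglongrightarrow> (\<integral>s. 0 \<partial>(lborel :: real measure))"
      proof (rule integral_dominated_convergence)
        show "integrable lborel (\<lambda>s. \<bar>V s\<bar>)" using V by simp
        show "AE s in lborel. (\<lambda>n. indicator {a<..<a + \<delta> n} s * \<bar>V s\<bar>) \<longlonglongrightarrow> 0"
        proof (rule AE_I2)
          fix s
          show "(\<lambda>n. indicator {a<..<a + \<delta> n} s * \<bar>V s\<bar>) \<longlonglongrightarrow> 0"
          proof (cases "a < s")
            case True
            then have "eventually (\<lambda>n. \<delta> n < s - a) sequentially"
              by (intro order_tendstoD(2)[OF \<delta>_lim]) simp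
            then have "eventually (\<lambda>n. indicator {a<..<a + \<delta> n} s * \<bar>V s\<bar> = 0) sequentially"
              by (rule eventually_mono) (auto simp: indicator_def)
            then show ?thesis by (rule tendsto_eventually)
          qed simp
        qed
        show "AE s in lborel. norm (indicator {a<..<a + \<delta> n} s * \<bar>V s\<bar>) \<le> \<bar>V s\<bar>" for n
          by (auto simp: indicator_def)
      qed measurable
    qed (use \<alpha> \<delta> in \<open>auto simp: less_imp_le Gamma_real_pos[THEN less_imp_neq, symmetric]\<close>)
    ultimately have "\<bar>c\<bar> \<le> M * (0 powr (1 - \<alpha>) / Gamma (2 - \<alpha>)) + (\<integral>s. 0 \<partial>(lborel :: real measure))"
      by (intro LIMSEQ_le_const) auto
    then show "c = 0" by simp
  qed
  define I where "I s = (\<integral>r. frac_kernel \<alpha> (s - r) * V r \<partial>lborel)" for s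
  define \<Phi> where "\<Phi> s = (\<integral>r. frac_kernel 1 (s - r) * V r \<partial>lborel)" for s
  have [measurable]: "I \<in> borel_measurable borel" "\<Phi> \<in> borel_measurable borel" "G \<in> borel_measurable borel"
    unfolding I_def \<Phi>_def G_eq[abs_def] by measurable
  have \<Phi>_eq: "\<Phi> x = (\<integral>s. indicator {a<..<x} s * V s \<partial>lborel)" for x
    unfolding \<Phi>_def using V(2)
    by (intro Bochner_Integration.integral_cong) (auto simp: frac_kernel_1 indicator_def)
  have V_supp: "V r = 0" if "r < a" for r using V(2) that by simp
  have conv_eq: "(\<integral>s. frac_kernel 1 (t - s) * Z s \<partial>lborel) = (\<integral>s. frac_kernel 1 (t - s) * I s \<partial>lborel)" if "t \<le> b" for t
  proof -
    have "(\<integral>s. frac_kernel 1 (t - s) * Z s \<partial>lborel) = (\<integral>s. frac_kernel \<alpha> (t - s) * G s \<partial>lborel)"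
      using frac_kernel_conv_assoc(3)[of \<alpha> "1 - \<alpha>" Z a t] \<alpha> Z by (simp add: G_eq)
    also have "\<dots> = (\<integral>s. frac_kernel \<alpha> (t - s) * \<Phi> s \<partial>lborel)"
    proof (rule integral_cong_AE)
      \<comment> \<open>The representation is known only inside (a, b). Left of it both functions
        vanish; right of it the kernel does, as t \<le> b.\<close>
      show "AE s in lborel. frac_kernel \<alpha> (t - s) * G s = frac_kernel \<alpha> (t - s) * \<Phi> s"
        using G_V
      proof eventually_elim
        case (elim s)
        consider "s \<le> a" | "s \<in> {a<..<b}" | "b \<le> s" by force
        then show ?case
        proof cases
          case 1
          then show ?thesis by (simp add: G0 \<Phi>_eq)
        next
          case 2
          then show ?thesis using elim \<open>c = 0\<close> by (simp add: \<Phi>_eq)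
        next
          case 3
          then show ?thesis using that by (simp add: frac_kernel_def)
        qed
      qed
    qed measurable
    also have "\<dots> = (\<integral>r. frac_kernel (\<alpha> + 1) (t - r) * V r \<partial>lborel)"
      unfolding \<Phi>_def using \<alpha> V V_supp by (intro frac_kernel_conv_assoc(3)[where a=a]) auto
    also have "\<dots> = (\<integral>s. frac_kernel 1 (t - s) * I s \<partial>lborel)"
      unfolding I_def using \<alpha> V V_supp
      by (subst frac_kernel_conv_assoc(3)[where a=a]) (auto simp: add.commute)
    finally show ?thesis .
  qed
  \<comment> \<open>Cutting off at \<open>b\<close> makes the difference integrable over the whole
    line and is invisible to the order-one integrals for t \<le> b.\<close>
  define d where "d s = frac_kernel 1 (b - s) * Z s - frac_kernel 1 (b - s) * I s" for s
  have I_int: "integrable lborel (\<lambda>s. frac_kernel 1 (t - s) * I s)" for t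
    unfolding I_def using \<alpha> V V_supp by (intro frac_kernel_conv_assoc(2)[where a=a]) auto
  have Z_int: "integrable lborel (\<lambda>s. frac_kernel 1 (t - s) * Z s)" for t
    using Z by (intro frac_kernel_mult_integrable[where a=a]) auto
  have "AE \<tau> in lborel. \<tau> < b \<longrightarrow> d \<tau> = 0"
  proof (rule integral_zero_all_imp_AE_zero)
    show "integrable lborel d" unfolding d_def by (intro Bochner_Integration.integrable_diff I_int Z_int)
    fix t assume t: "t \<le> b"
    have "frac_kernel 1 (t - s) * d s = frac_kernel 1 (t - s) * Z s - frac_kernel 1 (t - s) * I s" for s
      using t by (auto simp: d_def frac_kernel_1 indicator_def)
    then show "(\<integral>s. frac_kernel 1 (t - s) * d s \<partial>lborel) = 0"
      using conv_eq[OF t] I_int Z_int by simp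
  qed
  then have "AE x in lborel. x \<in> {a<..<b} \<longrightarrow> g x = (\<integral>s. frac_kernel \<alpha> (x - s) * V s \<partial>lborel)"
    by eventually_elim (auto simp: d_def frac_kernel_1 Z_def zero_extension_def I_def)
  with V show thesis by (rule that)
qed

section \<open>The Caputo derivative\<close>

lemma has_weak_derivative_cong:
  assumes "\<And>x. x \<in> {a<..<b} \<Longrightarrow> u x = u' x" "has_weak_derivative u v a b"
  shows "has_weak_derivative u' v a b"
proof -
  have "(LINT x:{a<..<b}|lebesgue. u x * deriv \<phi> x) = (LINT x:{a<..<b}|lebesgue. u' x * deriv \<phi> x)" for \<phi>
    using assms(1) by (intro set_lebesgue_integral_cong) auto
  moreover have "u absolutely_integrable_on {a<..<b} \<longleftrightarrow> u' absolutely_integrable_on {a<..<b}"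
    using assms(1) by (intro set_integrable_cong) auto
  ultimately show ?thesis using assms(2) by (simp add: has_weak_derivative_def)
qed

text \<open>Bridges the W11 hypothesis on \<open>f\<close> and the Caputo derivative, which acts on
  \<open>f\<close> minus a constant. By reflection the convolution of a constant is the primitive of
  a multiple of the kernel itself, and that kernel is integrable on the interval.\<close>

lemma frac_conv_const_weak_derivative:
  assumes \<alpha>: "0 < \<alpha>" "\<alpha> < 1" and "a < b"
  shows "\<exists>v. has_weak_derivative (frac_conv (1 - \<alpha>) a b (\<lambda>_. c)) v a b"
proof -
  define \<phi> where "\<phi> r = indicator {a..b} r * frac_kernel (1 - \<alpha>) (r - a) * c" for r
  have [measurable]: "\<phi> \<in> borel_measurable borel" unfolding \<phi>_def by measurable
  \<comment> \<open>Integrability is borrowed from the semigroup law; with b + 1 the order-one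
    factor equals 1 on all of [a, b], including s = b.\<close>
  have "integrable lborel (\<lambda>s. indicator {a..b} s *\<^sub>R (frac_kernel 1 (b + 1 - s) * frac_kernel (1 - \<alpha>) (s - a)) * c)"
    using \<alpha> by (intro integrable_mult_left integrable_mult_indicator frac_kernel_semigroup(1)) auto
  moreover have eq: "indicator {a..b} s *\<^sub>R (frac_kernel 1 (b + 1 - s) * frac_kernel (1 - \<alpha>) (s - a)) * c = \<phi> s" for s
    by (auto simp: \<phi>_def frac_kernel_1 indicator_def)
  ultimately have \<phi>: "integrable lborel \<phi>" unfolding eq by blast
  have "has_weak_derivative (frac_conv (1 - \<alpha>) a b (\<lambda>_. c)) \<phi> a b"
  proof (rule has_weak_derivative_cong[OF _ has_weak_derivative_indefinite_integral[OF \<phi> \<open>a < b\<close>]])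
    fix t assume t: "t \<in> {a<..<b}"
    have [measurable]: "zero_extension a b (\<lambda>_. c) \<in> borel_measurable borel"
      unfolding zero_extension_def by measurable
    have "frac_conv (1 - \<alpha>) a b (\<lambda>_. c) t = (\<integral>s. frac_kernel (1 - \<alpha>) (t - s) * zero_extension a b (\<lambda>_. c) s \<partial>lborel)"
      unfolding frac_conv_def by (rule convolve_eq_lborel) measurable
    \<comment> \<open>The reflection s = t + a - r exchanges the two endpoints and moves the
      singularity from s = t to r = a.\<close>
    also have "\<dots> = (\<integral>r. frac_kernel (1 - \<alpha>) (t - (t + a + (-1) * r)) * zero_extension a b (\<lambda>_. c) (t + a + (-1) * r) \<partial>lborel)"
      by (subst lborel_integral_real_affine[where c="-1" and t="t + a"]) simp_all
    also have "\<dots> = (\<integral>r. indicator {a<..<t} r * \<phi> r \<partial>lborel)"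
    proof (rule integral_cong_AE)
      show "AE r in lborel. frac_kernel (1 - \<alpha>) (t - (t + a + (-1) * r)) * zero_extension a b (\<lambda>_. c) (t + a + (-1) * r)
          = indicator {a<..<t} r * \<phi> r"
        using AE_lborel_singleton[of t]
        by eventually_elim (use t in \<open>auto simp: \<phi>_def frac_kernel_def zero_extension_def indicator_def\<close>)
    qed measurable
    finally show "(\<integral>s. indicator {a<..<t} s * \<phi> s \<partial>lborel) = frac_conv (1 - \<alpha>) a b (\<lambda>_. c) t" by simp
  qed
  then show ?thesis by blast
qed

text \<open>\<open>caputo_deriv\<close> is a choice operator and has content only once some weak
  derivative exists. Linearity of the convolution supplies one from those of \<open>f\<close> and of
  the constant.\<close>

lemma has_weak_derivative_caputo_deriv:
  assumes \<alpha>: "0 < \<alpha>" "\<alpha> < 1" and "a < b" and f: "continuous_on {a..b} f"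
    and "frac_conv (1 - \<alpha>) a b f \<in> W11 a b"
  shows "has_weak_derivative (frac_conv (1 - \<alpha>) a b (\<lambda>t. f t - f a)) (caputo_deriv \<alpha> a b f) a b"
proof -
  obtain v where v: "has_weak_derivative (frac_conv (1 - \<alpha>) a b f) v a b"
    using assms by (auto simp: W11_def)
  obtain w where w: "has_weak_derivative (frac_conv (1 - \<alpha>) a b (\<lambda>_. f a)) w a b"
    using frac_conv_const_weak_derivative[OF \<alpha> \<open>a < b\<close>] by blast
  have facts: "frac_conv (1 - \<alpha>) a b h t = (\<integral>s. frac_kernel (1 - \<alpha>) (t - s) * zero_extension a b h s \<partial>lborel)
     \<and> integrable lborel (\<lambda>s. frac_kernel (1 - \<alpha>) (t - s) * zero_extension a b h s)"
    if "continuous_on {a..b} h" for h t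
  proof -
    obtain M where Z: "zero_extension a b h \<in> borel_measurable borel"
      "integrable lborel (zero_extension a b h)" "\<And>s. \<bar>zero_extension a b h s\<bar> \<le> M"
      "\<And>s. s < a \<Longrightarrow> zero_extension a b h s = 0"
      by (rule zero_extension_facts[OF \<open>continuous_on {a..b} h\<close>]) (rule that)
    have "0 < 1 - \<alpha>" using \<alpha> by simp
    from convolve_eq_lborel[OF frac_kernel_measurable Z(1)] frac_kernel_bounded_integrable(1)[OF this Z(1,3,4)]
    show ?thesis by (simp add: frac_conv_def)
  qed
  have "frac_conv (1 - \<alpha>) a b f t - frac_conv (1 - \<alpha>) a b (\<lambda>_. f a) t = frac_conv (1 - \<alpha>) a b (\<lambda>t. f t - f a) t" for t
  proof -
    have "zero_extension a b (\<lambda>t. f t - f a) s = zero_extension a b f s - zero_extension a b (\<lambda>_. f a) s" for s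
      by (simp add: zero_extension_def)
    then show ?thesis
      using facts[of f t] facts[of "\<lambda>_. f a" t] facts[of "\<lambda>t. f t - f a" t] f
      by (simp add: right_diff_distrib continuous_on_diff)
  qed
  then have "has_weak_derivative (frac_conv (1 - \<alpha>) a b (\<lambda>t. f t - f a)) (\<lambda>x. v x - w x) a b"
    by (intro has_weak_derivative_cong[OF _ has_weak_derivative_diff[OF v w]])
  then show ?thesis
    unfolding caputo_deriv_def riemann_liouville_deriv_def weak_deriv_def
    by (rule someI[where P="\<lambda>v. has_weak_derivative _ v a b"])
qed

section \<open>The inequality at a generic time\<close>

theorem theorem42:
  fixes \<alpha> t0 t1 :: real and f :: "real \<Rightarrow> real"
  assumes "0 < \<alpha>" and "\<alpha> < 1" and "t0 < t1"
    and "continuous_on {t0..t1} f"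
    and "frac_conv (1 - \<alpha>) t0 t1 f \<in> W11 t0 t1"
    and "frac_conv (1 - \<alpha>) t0 t1 (\<lambda>t. (f t)\<^sup>2) \<in> W11 t0 t1"
  shows "AE t in lebesgue. t \<in> {t0..t1} \<longrightarrow>
           caputo_deriv \<alpha> t0 t1 (\<lambda>s. (f s)\<^sup>2) t \<le> 2 * caputo_deriv \<alpha> t0 t1 f t * f t"
proof -
  note cont = assms(4)
  have cont2: "continuous_on {t0..t1} (\<lambda>t. (f t)\<^sup>2)" using cont by (intro continuous_intros)
  have cont': "continuous_on {t0..t1} (\<lambda>t. f t - f t0)" "continuous_on {t0..t1} (\<lambda>t. (f t)\<^sup>2 - (f t0)\<^sup>2)"
    using cont by (auto intro!: continuous_intros)
  obtain V1 where V1: "integrable lborel V1" "\<And>x. x \<notin> {t0<..<t1} \<Longrightarrow> V1 x = 0"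
    "AE x in lborel. x \<in> {t0<..<t1} \<longrightarrow> caputo_deriv \<alpha> t0 t1 f x = V1 x"
    "AE x in lborel. x \<in> {t0<..<t1} \<longrightarrow> f x - f t0 = (\<integral>s. frac_kernel \<alpha> (x - s) * V1 s \<partial>lborel)"
    by (rule frac_conv_weak_derivative_inversion[OF assms(1-3) cont'(1)
          has_weak_derivative_caputo_deriv[OF assms(1-3) cont assms(5)]]) (rule that)
  obtain V2 where V2: "integrable lborel V2" "\<And>x. x \<notin> {t0<..<t1} \<Longrightarrow> V2 x = 0"
    "AE x in lborel. x \<in> {t0<..<t1} \<longrightarrow> caputo_deriv \<alpha> t0 t1 (\<lambda>s. (f s)\<^sup>2) x = V2 x"
    "AE x in lborel. x \<in> {t0<..<t1} \<longrightarrow> (f x)\<^sup>2 - (f t0)\<^sup>2 = (\<integral>s. frac_kernel \<alpha> (x - s) * V2 s \<partial>lborel)"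
    by (rule frac_conv_weak_derivative_inversion[OF assms(1-3) cont'(2)
          has_weak_derivative_caputo_deriv[OF assms(1-3) cont2 assms(6)]]) (rule that)
  have supp: "\<forall>x. x \<notin> {t0<..<t1} \<longrightarrow> V1 x = 0" "\<forall>x. x \<notin> {t0<..<t1} \<longrightarrow> V2 x = 0"
    using V1(2) V2(2) by blast+
  \<comment> \<open>The shift by 2 keeps the values strictly below \<alpha> already at n =
    0.\<close>
  define \<epsilon> where "\<epsilon> n = \<alpha> / real (n + 2)" for n
  have \<epsilon>: "0 < \<epsilon> n" "\<epsilon> n < \<alpha>" for n
  proof -
    show "0 < \<epsilon> n" using assms(1) by (simp add: \<epsilon>_def)
    have "\<alpha> / real (n + 2) < \<alpha> / 1" using assms(1) by (intro divide_strict_left_mono) auto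
    then show "\<epsilon> n < \<alpha>" by (simp add: \<epsilon>_def)
  qed
  have \<epsilon>_lim: "\<epsilon> \<longlonglongrightarrow> 0"
    unfolding \<epsilon>_def using LIMSEQ_ignore_initial_segment[OF lim_const_over_n[of \<alpha>], of 2] by simp
  \<comment> \<open>Outer order 1 brings the total order above 1, so pointwise convergence almost
    everywhere holds for every positive order \<gamma>.\<close>
  have int: "AE s in lborel. s < t1 \<longrightarrow> integrable lborel (\<lambda>r. frac_kernel \<gamma> (s - r) * V r)"
    if "0 < \<gamma>" "integrable lborel V" "\<forall>x. x \<notin> {t0<..<t1} \<longrightarrow> V x = 0" for \<gamma> V
    using that by (intro frac_kernel_conv_assoc(1)[of 1 \<gamma> V t0 t1]) auto
  \<comment> \<open>Besides the two inversion identities, convergence is recorded: a divergent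
    integral has the default value 0 and could not be split linearly.\<close>
  define good where "good x \<longleftrightarrow>
      integrable lborel (\<lambda>s. frac_kernel \<alpha> (x - s) * V1 s) \<and> integrable lborel (\<lambda>s. frac_kernel \<alpha> (x - s) * V2 s) \<and>
      f x - f t0 = (\<integral>s. frac_kernel \<alpha> (x - s) * V1 s \<partial>lborel) \<and>
      (f x)\<^sup>2 - (f t0)\<^sup>2 = (\<integral>s. frac_kernel \<alpha> (x - s) * V2 s \<partial>lborel)" for x
  have good: "AE x in lborel. x \<in> {t0<..<t1} \<longrightarrow> good x"
    using V1(4) V2(4) int[OF assms(1) V1(1) supp(1)] int[OF assms(1) V2(1) supp(2)]
    by eventually_elim (simp add: good_def)
  have int_\<epsilon>: "AE s in lborel. \<forall>n. s < t1 \<longrightarrow> integrable lborel (\<lambda>r. frac_kernel (\<epsilon> n) (s - r) * V r)"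
    if "integrable lborel V" "\<forall>x. x \<notin> {t0<..<t1} \<longrightarrow> V x = 0" for V
    unfolding AE_all_countable using int[OF \<epsilon>(1) that] by blast
  have "AE \<tau> in lborel. \<tau> \<in> {t0..t1} \<longrightarrow> caputo_deriv \<alpha> t0 t1 (\<lambda>s. (f s)\<^sup>2) \<tau> \<le> 2 * caputo_deriv \<alpha> t0 t1 f \<tau> * f \<tau>"
    using good V1(3) V2(3) int_\<epsilon>[OF V1(1) supp(1)] int_\<epsilon>[OF V2(1) supp(2)] AE_left_density[OF V1(1)] AE_left_density[OF V2(1)]
      AE_lborel_singleton[of t0] AE_lborel_singleton[of t1]
  proof eventually_elim
    case (elim \<tau>)
    show ?case
    proof
      assume "\<tau> \<in> {t0..t1}"
      then have \<tau>: "\<tau> \<in> {t0<..<t1}" using elim by auto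
      define \<psi> where "\<psi> s = V2 s - 2 * f \<tau> * V1 s" for s
      have \<psi>: "integrable lborel \<psi>" unfolding \<psi>_def using V1 V2 by simp
      have split: "frac_kernel \<gamma> (x - s) * \<psi> s = frac_kernel \<gamma> (x - s) * V2 s - 2 * f \<tau> * (frac_kernel \<gamma> (x - s) * V1 s)" for \<gamma> x s
        by (simp add: \<psi>_def algebra_simps)
      \<comment> \<open>Completing the square; the choice of factor 2 * f \<tau> in
        \<open>\<psi>\<close> removes the linear term in f x - f \<tau>.\<close>
      have at_good: "integrable lborel (\<lambda>s. frac_kernel \<alpha> (x - s) * \<psi> s) \<and>
          (\<integral>s. frac_kernel \<alpha> (x - s) * \<psi> s \<partial>lborel) = (f x - f \<tau>)\<^sup>2 - (f \<tau> - f t0)\<^sup>2" if "good x" for x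
      proof -
        have "(\<integral>s. frac_kernel \<alpha> (x - s) * \<psi> s \<partial>lborel) = (f x)\<^sup>2 - (f t0)\<^sup>2 - 2 * f \<tau> * (f x - f t0)"
          using that unfolding split good_def by simp
        also have "\<dots> = (f x - f \<tau>)\<^sup>2 - (f \<tau> - f t0)\<^sup>2"
          by (simp add: power2_eq_square algebra_simps)
        finally have "(\<integral>s. frac_kernel \<alpha> (x - s) * \<psi> s \<partial>lborel) = (f x - f \<tau>)\<^sup>2 - (f \<tau> - f t0)\<^sup>2" .
        moreover have "integrable lborel (\<lambda>s. frac_kernel \<alpha> (x - s) * \<psi> s)"
          using that unfolding split good_def by simp
        ultimately show ?thesis by blast
      qed
      have good_\<tau>: "good \<tau>" using elim \<tau> by simp
      have int_\<tau>: "integrable lborel (\<lambda>s. frac_kernel (\<epsilon> n) (\<tau> - s) * \<psi> s)" for n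
        unfolding split using elim \<tau> by simp
      have min: "AE t in lborel. t < \<tau> \<longrightarrow> (\<integral>s. frac_kernel \<alpha> (\<tau> - s) * \<psi> s \<partial>lborel) \<le> (\<integral>s. frac_kernel \<alpha> (t - s) * \<psi> s \<partial>lborel)"
        using good
      proof eventually_elim
        case (elim t)
        show ?case
        proof
          assume "t < \<tau>"
          have lhs: "(\<integral>s. frac_kernel \<alpha> (\<tau> - s) * \<psi> s \<partial>lborel) = - (f \<tau> - f t0)\<^sup>2"
            using at_good[OF good_\<tau>] by simp
          show "(\<integral>s. frac_kernel \<alpha> (\<tau> - s) * \<psi> s \<partial>lborel) \<le> (\<integral>s. frac_kernel \<alpha> (t - s) * \<psi> s \<partial>lborel)"
          \<comment> \<open>The minimum must hold on the whole half-line t < \<tau>. Up to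
            \<open>t0\<close> the fractional integral is 0, because \<open>\<psi>\<close> is
            supported to the right; this is still above the value at \<open>\<tau>\<close>, which is
            minus a square.\<close>
          proof (cases "t0 < t")
            case True
            then have "good t" using elim \<open>t < \<tau>\<close> \<tau> by simp
            from at_good[OF this] lhs show ?thesis by simp
          next
            case False
            have zero: "frac_kernel \<alpha> (t - s) * \<psi> s = 0" for s
            proof (cases "s < t")
              case True
              with False have "V1 s = 0" "V2 s = 0" using V1(2)[of s] V2(2)[of s] by auto
              then show ?thesis by (simp add: \<psi>_def)
            qed (simp add: frac_kernel_def)
            show ?thesis unfolding lhs zero by simp
          qed
        qed
      qed
      \<comment> \<open>Here \<open>f \<tau>\<close> is a fixed number, so the density of
        \<open>\<psi>\<close> at \<open>\<tau>\<close> is the linear combination of those of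
        \<open>V1\<close> and \<open>V2\<close>.\<close>
      have "((\<lambda>h. (\<integral>u. indicator {0<..<h} u * \<psi> (\<tau> - u) \<partial>lborel) / h) \<longlongrightarrow> \<psi> \<tau>) (at_right 0)"
      proof -
        have ind_int: "integrable lborel (\<lambda>u. indicator {0<..<h} u * V (\<tau> - u))" if "integrable lborel V" for V :: "real \<Rightarrow> real" and h
          using integrable_mult_indicator[OF _ lborel_integrable_real_affine[OF that, of "-1" \<tau>], of "{0<..<h}"] by simp
        have eq: "(\<integral>u. indicator {0<..<h} u * \<psi> (\<tau> - u) \<partial>lborel) / h
           = (\<integral>u. indicator {0<..<h} u * V2 (\<tau> - u) \<partial>lborel) / h
             - 2 * f \<tau> * ((\<integral>u. indicator {0<..<h} u * V1 (\<tau> - u) \<partial>lborel) / h)" for h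
        proof -
          have "indicator {0<..<h} u * \<psi> (\<tau> - u) = indicator {0<..<h} u * V2 (\<tau> - u)
              - 2 * f \<tau> * (indicator {0<..<h} u * V1 (\<tau> - u))" for u
            by (simp add: \<psi>_def algebra_simps)
          then show ?thesis using ind_int[OF V1(1)] ind_int[OF V2(1)] by (simp add: diff_divide_distrib)
        qed
        show ?thesis
          unfolding eq unfolding \<psi>_def by (intro tendsto_intros elim(6,7))
      qed
      then have "\<psi> \<tau> \<le> 0"
      proof (rule left_density_nonpos[OF \<psi> _ \<epsilon>(1) _ \<epsilon>_lim int_\<tau>])
        show "\<epsilon> n < 1" for n using \<epsilon>(2)[of n] assms(2) by simp
        show "(\<integral>s. frac_kernel (\<epsilon> n) (\<tau> - s) * \<psi> s \<partial>lborel) \<le> 0" for n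
          using \<psi> at_good[OF good_\<tau>] int_\<tau> min
          by (intro frac_integral_nonpos_at_minimum[OF \<epsilon> assms(2)]) auto
      qed
      then show "caputo_deriv \<alpha> t0 t1 (\<lambda>s. (f s)\<^sup>2) \<tau> \<le> 2 * caputo_deriv \<alpha> t0 t1 f \<tau> * f \<tau>"
        using elim \<tau> by (simp add: \<psi>_def mult_ac)
    qed
  qed
  then show ?thesis by (simp add: AE_completion_iff)
qed

end
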